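(* Let $D\ge 1$ and let $M_1,\dots,M_D$ be positive integers, $N=\prod_{d=1}^{D}M_d$, and $p_1,\dots,p_D\in[0,1]$ with $\gamma=\sum_{d=1}^{D}p_d(M_d-1)>0$. Let $\mathcal{G}_{\mathrm{perc}}$ be the random graph obtained from the $D$-dimensional lattice graph $\mathcal{G}_{\mathrm{lat}}$ with size $M_d$ along dimension $d$ by independently including each link along lattice dimension $d$ with probability $p_d$, and let $W=\frac{1}{\gamma}A(\mathcal{G}_{\mathrm{perc}})$. Let $F_N$ be the deterministic equivalent distribution function for the empirical spectral distribution of $W$ given by Girko's K1 equation, and let $C(z)$ be the associated matrix (both defined in the context). Then for every $z$ with $\operatorname{Im}\{z\}\neq 0$ there exist $2^D$ complex values $\alpha_{i_1,\dots,i_D}(z)$, $i_1,\dots,i_D\in\{0,1\}$, with $$C(z)=\sum_{i_1,\dots,i_D=0}^{1}\alpha_{i_1,\dots,i_D}(z)\bigotimes_{d=1}^{D}Y_{di_d},\qquad Y_{di_d}=\begin{cases}K_{M_d}& i_d=0\\ I_{M_d}& i_d=1,\end{cases}$$ such that the Stieltjes transform of $F_N$ is $$S_{F_N}(z)=\alpha_{1,\dots,1}(z),$$ and the values $\alpha_{i_1,\dots,i_D}(z)$ solve the system of $2^D$ rational equations, one for each $(j_1,\dots,j_D)\in\{0,1\}^D$, $$\sum_{i_1,\dots,i_D=0}^{1}\alpha_{i_1,\dots,i_D}(z)\prod_{d=1}^{D}\lambda_{di_d}(j_d)=\left(\frac{1}{\gamma}\left(\sum_{d=1}^{D}p_d\lambda_{d0}(j_d)\right)-z-\frac{1}{\gamma^2}\left(\sum_{d=1}^{D}p_d(1-p_d)(M_d-1)\right)\alpha_{1,\dots,1}(z)\right)^{-1},$$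 where $$\lambda_{di_d}(j_d)=\begin{cases}M_d-1& i_d=0,\ j_d=0\\ -1& i_d=0,\ j_d=1\\ 1& i_d=1.\end{cases}$$
   Context: $I_M$ is the $M\times M$ identity matrix and $K_M$ is the adjacency matrix of the complete graph on $M$ nodes (zeros on the diagonal, ones elsewhere). The nodes of the $D$-dimensional lattice graph $\mathcal{G}_{\mathrm{lat}}$ with sizes $M_1,\dots,M_D$ are the ordered $D$-tuples whose $d$th entry takes one of $M_d$ symbols; two nodes are linked iff their tuples differ in exactly one entry, and the link is "along lattice dimension $d$" if they differ in the $d$th entry. Nodes are ordered so that $$A(\mathcal{G}_{\mathrm{lat}})=\sum_{j=1}^{D}\bigotimes_{d=1}^{D}X_{dj},\qquad X_{dj}=K_{M_d}\text{ if } j=d,\quad X_{dj}=I_{M_d}\text{ if } j\neq d,$$ where the $j$th summand collects the links along dimension $j$. Links are undirected, so $A(\mathcal{G}_{\mathrm{perc}})$ is symmetric with independent entries on the upper triangle, and $\gamma$ is the expected node degree. Put $B=\operatorname{E}[W]$ and $H=W-\operatorname{E}[W]$. Let $L$ be the set of complex-valued functions $X(z)$, analytic on $\{z\in\mathbb{C}:\operatorname{Im}\{z\}\neq0\}$, with $\operatorname{Im}\{z\}\operatorname{Im}\{X(z)\}>0$. It is a known theorem (Girko's K1 equation) that there is a unique family $C_{kk}(z)$, $k=1,\dots,N$, in $L$ solving $$C_{kk}(z)=\left[\left(B-zI_N-\left(\delta_{lj}\sum_{s=1}^{N}C_{ss}(z)\operatorname{E}[H_{js}^2]\right)_{l,j=1}^{l,j=N}\right)^{-1}\right]_{kk},\qquad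 k=1,\dots,N,$$ where $\left(X_{lj}\right)_{l,j=1}^{l,j=N}$ denotes the $N\times N$ matrix with entries $X_{lj}$ and $\delta_{lj}$ is the Kronecker delta. Then $$C(z)=\left(B-zI_N-\left(\delta_{lj}\sum_{s=1}^{N}C_{ss}(z)\operatorname{E}[H_{js}^2]\right)_{l,j=1}^{l,j=N}\right)^{-1},$$ whose $k$th diagonal entry is $C_{kk}(z)$. The distribution function $F_N$ is the one with Stieltjes transform $$S_{F_N}(z)=\int_{-\infty}^{\infty}\frac{1}{x-z}\,dF_N(x)=\frac{1}{N}\sum_{k=1}^{N}C_{kk}(z),\qquad \operatorname{Im}\{z\}\neq 0.$$ *)

theory Defs
  imports "HOL-Probability.Probability" "Jordan_Normal_Form.Gauss_Jordan_Elimination"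
begin

section \<open>Kronecker products\<close>

definition kronecker :: "'a::semiring_1 mat \<Rightarrow> 'a mat \<Rightarrow> 'a mat" where
  "kronecker A B = Matrix.mat (dim_row A * dim_row B) (dim_col A * dim_col B)
     (\<lambda>(r, c). A $$ (r div dim_row B, c div dim_col B) * B $$ (r mod dim_row B, c mod dim_col B))"

text \<open>\<open>kronecker_prod X D\<close> is the product \<open>X 1 \<otimes> \<dots> \<otimes> X D\<close>.\<close>

primrec kronecker_prod :: "(nat \<Rightarrow> 'a::semiring_1 mat) \<Rightarrow> nat \<Rightarrow> 'a mat" where
  "kronecker_prod X 0 = 1\<^sub>m 1"
| "kronecker_prod X (Suc D) = kronecker (kronecker_prod X D) (X (Suc D))"

definition complete_mat :: "nat \<Rightarrow> 'a::semiring_1 mat" where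
  "complete_mat m = Matrix.mat m m (\<lambda>(i, j). if i = j then 0 else 1)"


section \<open>The lattice graph and its percolation\<close>

definition lattice_nodes :: "nat \<Rightarrow> (nat \<Rightarrow> nat) \<Rightarrow> (nat \<Rightarrow> nat) set" where
  "lattice_nodes D M = (\<Pi>\<^sub>E d\<in>{1..D}. {..<M d})"

text \<open>Undirected links are two-element sets of nodes.\<close>

definition lattice_links_along :: "nat \<Rightarrow> (nat \<Rightarrow> nat) \<Rightarrow> nat \<Rightarrow> (nat \<Rightarrow> nat) set set" where
  "lattice_links_along D M d =
     {{x, y} | x y. x \<in> lattice_nodes D M \<and> y \<in> lattice_nodes D M \<and>
                    {e \<in> {1..D}. x e \<noteq> y e} = {d}}"

definition lattice_links :: "nat \<Rightarrow> (nat \<Rightarrow> nat) \<Rightarrow> (nat \<Rightarrow> nat) set set" where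
  "lattice_links D M = (\<Union>d\<in>{1..D}. lattice_links_along D M d)"

definition adjacency_mat :: "nat \<Rightarrow> (nat \<Rightarrow> 'v) \<Rightarrow> 'v set set \<Rightarrow> 'a::semiring_1 mat" where
  "adjacency_mat N \<nu> E = Matrix.mat N N (\<lambda>(k, l). if {\<nu> k, \<nu> l} \<in> E then 1 else 0)"

text \<open>The numberings of the nodes by \<open>0, \<dots>, N - 1\<close> for which the links along each dimension
  \<open>j\<close> have the adjacency matrix \<open>I \<otimes> \<dots> \<otimes> K \<otimes> \<dots> \<otimes> I\<close>, with \<open>K\<close> in position \<open>j\<close>.\<close>

definition lattice_ordering :: "nat \<Rightarrow> (nat \<Rightarrow> nat) \<Rightarrow> (nat \<Rightarrow> nat \<Rightarrow> nat) \<Rightarrow> bool" where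
  "lattice_ordering D M \<nu> \<longleftrightarrow>
     bij_betw \<nu> {..<\<Prod>d=1..D. M d} (lattice_nodes D M) \<and>
     (\<forall>j\<in>{1..D}. adjacency_mat (\<Prod>d=1..D. M d) \<nu> (lattice_links_along D M j) =
        (kronecker_prod (\<lambda>d. if d = j then complete_mat (M d) else 1\<^sub>m (M d)) D :: real mat))"

definition lattice_percolation ::
    "'w measure \<Rightarrow> nat \<Rightarrow> (nat \<Rightarrow> nat) \<Rightarrow> (nat \<Rightarrow> real) \<Rightarrow> ('w \<Rightarrow> (nat \<Rightarrow> nat) set set) \<Rightarrow> bool" where
  "lattice_percolation P D M p G \<longleftrightarrow>
     prob_space P \<and>
     (\<forall>\<omega>\<in>space P. G \<omega> \<subseteq> lattice_links D M) \<and>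
     prob_space.indep_events P (\<lambda>e. {\<omega> \<in> space P. e \<in> G \<omega>}) (lattice_links D M) \<and>
     (\<forall>d\<in>{1..D}. \<forall>e\<in>lattice_links_along D M d. measure P {\<omega> \<in> space P. e \<in> G \<omega>} = p d)"


section \<open>Girko's K1 equation\<close>

definition expectation_mat :: "'w measure \<Rightarrow> nat \<Rightarrow> ('w \<Rightarrow> real mat) \<Rightarrow> real mat" where
  "expectation_mat P N W = Matrix.mat N N (\<lambda>(k, l). \<integral>\<omega>. W \<omega> $$ (k, l) \<partial>P)"

definition half_plane_class :: "(complex \<Rightarrow> complex) set" where
  "half_plane_class =
     {X. X analytic_on {z. Im z \<noteq> 0} \<and> (\<forall>z. Im z \<noteq> 0 \<longrightarrow> Im z * Im (X z) > 0)}"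

text \<open>The inverse below always exists if \<open>Im z \<noteq> 0\<close> and the functions \<open>c k\<close> are in
  \<^const>\<open>half_plane_class\<close>, because the imaginary part of the matrix is then definite.\<close>

definition girko_mat :: "'w measure \<Rightarrow> nat \<Rightarrow> ('w \<Rightarrow> real mat) \<Rightarrow> (nat \<Rightarrow> complex \<Rightarrow> complex) \<Rightarrow>
    complex \<Rightarrow> complex mat" where
  "girko_mat P N W c z =
     (let B = expectation_mat P N W;
          H = (\<lambda>\<omega>. W \<omega> - B)
      in the (mat_inverse
           (map_mat complex_of_real B - z \<cdot>\<^sub>m 1\<^sub>m N -
            Matrix.mat N N (\<lambda>(l, j). if l = j
              then \<Sum>s<N. c s z * complex_of_real (\<integral>\<omega>. (H \<omega> $$ (j, s))\<^sup>2 \<partial>P) else 0))))"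

definition girko_K1_solution ::
    "'w measure \<Rightarrow> nat \<Rightarrow> ('w \<Rightarrow> real mat) \<Rightarrow> (nat \<Rightarrow> complex \<Rightarrow> complex) \<Rightarrow> bool" where
  "girko_K1_solution P N W c \<longleftrightarrow>
     (\<forall>k<N. c k \<in> half_plane_class) \<and>
     (\<forall>z. Im z \<noteq> 0 \<longrightarrow> (\<forall>k<N. c k z = girko_mat P N W c z $$ (k, k)))"

definition distribution_function :: "(real \<Rightarrow> real) \<Rightarrow> bool" where
  "distribution_function F \<longleftrightarrow>
     mono F \<and> (\<forall>x. continuous (at_right x) F) \<and>
     (F \<longlongrightarrow> 0) at_bot \<and> (F \<longlongrightarrow> 1) at_top"

definition stieltjes_transform :: "(real \<Rightarrow> real) \<Rightarrow> complex \<Rightarrow> complex" where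
  "stieltjes_transform F z = (\<integral>x. 1 / (complex_of_real x - z) \<partial>interval_measure F)"

definition K1_equivalent ::
    "'w measure \<Rightarrow> nat \<Rightarrow> ('w \<Rightarrow> real mat) \<Rightarrow> (nat \<Rightarrow> complex \<Rightarrow> complex) \<Rightarrow> (real \<Rightarrow> real) \<Rightarrow> bool" where
  "K1_equivalent P N W c F \<longleftrightarrow>
     girko_K1_solution P N W c \<and> distribution_function F \<and>
     (\<forall>z. Im z \<noteq> 0 \<longrightarrow> stieltjes_transform F z = 1 / of_nat N * (\<Sum>k<N. c k z))"


section \<open>Coefficients of the rational equations\<close>

text \<open>The eigenvalues of \<^term>\<open>complete_mat m\<close> (\<open>i = 0\<close>) and of the identity matrix (\<open>i = 1\<close>).\<close>

definition lattice_eigenvalue :: "nat \<Rightarrow> nat \<Rightarrow> nat \<Rightarrow> complex" where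
  "lattice_eigenvalue m i j = (if i = 0 then (if j = 0 then of_nat m - 1 else - 1) else 1)"


section \<open>Lattice orderings exist\<close>

lemma dim_kronecker_prod:
  assumes "\<And>d. d \<in> {1..D} \<Longrightarrow> X d \<in> carrier_mat (M d) (M d)"
  shows "kronecker_prod X D \<in> carrier_mat (\<Prod>d=1..D. M d) (\<Prod>d=1..D. M d)"
  using assms
proof (induction D)
  case (Suc D)
  have "X (Suc D) \<in> carrier_mat (M (Suc D)) (M (Suc D))" by (rule Suc.prems) simp
  moreover have "kronecker_prod X D \<in> carrier_mat (\<Prod>d=1..D. M d) (\<Prod>d=1..D. M d)"
    using Suc by simp
  ultimately show ?case by (auto simp: kronecker_def)
qed simp

lemma ordering_aux:
  assumes "\<forall>d\<in>{1..D}. 0 < M d"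
  shows "\<exists>\<nu>. bij_betw \<nu> {..<\<Prod>d=1..D. M d} (lattice_nodes D M) \<and>
     (\<forall>X::nat \<Rightarrow> real mat. (\<forall>d\<in>{1..D}. X d \<in> carrier_mat (M d) (M d)) \<longrightarrow>
        (\<forall>k<\<Prod>d=1..D. M d. \<forall>l<\<Prod>d=1..D. M d.
           kronecker_prod X D $$ (k, l) = (\<Prod>d=1..D. X d $$ (\<nu> k d, \<nu> l d))))"
  using assms
proof (induction D)
  case 0
  show ?case
    by (rule exI[of _ "\<lambda>_ _. undefined"]) (auto simp: lattice_nodes_def bij_betw_def lessThan_Suc)
next
  case (Suc D)
  define N where "N = (\<Prod>d=1..D. M d)"
  define m where "m = M (Suc D)"
  have m: "m > 0" using Suc.prems by (auto simp: m_def)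
  have NS: "(\<Prod>d=1..Suc D. M d) = N * m" by (simp add: N_def m_def)
  obtain \<nu> where bij: "bij_betw \<nu> {..<N} (lattice_nodes D M)"
    and ent: "\<And>X::nat \<Rightarrow> real mat. \<And>k l. (\<forall>d\<in>{1..D}. X d \<in> carrier_mat (M d) (M d)) \<Longrightarrow>
        k < N \<Longrightarrow> l < N \<Longrightarrow> kronecker_prod X D $$ (k, l) = (\<Prod>d=1..D. X d $$ (\<nu> k d, \<nu> l d))"
    using Suc.IH Suc.prems unfolding N_def by auto
  define \<mu> where "\<mu> k = (\<nu> (k div m))(Suc D := k mod m)" for k
  have dm: "k div m < N" if "k < N * m" for k
    using that by (simp add: less_mult_imp_div_less)
  have "bij_betw \<mu> {..<N * m} (lattice_nodes (Suc D) M)"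
  proof (rule bij_betwI')
    fix k l assume k: "k \<in> {..<N * m}" and l: "l \<in> {..<N * m}"
    show "\<mu> k = \<mu> l \<longleftrightarrow> k = l"
    proof
      assume eq: "\<mu> k = \<mu> l"
      have 1: "k mod m = l mod m" using fun_cong[OF eq, of "Suc D"] by (simp add: \<mu>_def)
      have n: "\<nu> (k div m) \<in> lattice_nodes D M" "\<nu> (l div m) \<in> lattice_nodes D M"
        using bij dm k l by (auto simp: bij_betw_def)
      have "\<nu> (k div m) = \<nu> (l div m)"
      proof (rule PiE_ext[OF n[unfolded lattice_nodes_def]])
        fix d assume "d \<in> {1..D}"
        then show "\<nu> (k div m) d = \<nu> (l div m) d"
          using fun_cong[OF eq, of d] by (simp add: \<mu>_def split: if_splits)
      qed
      then have "k div m = l div m" using bij dm k l by (auto simp: bij_betw_def inj_on_def)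
      with 1 show "k = l" by (metis div_mult_mod_eq)
    qed simp
  next
    fix k assume "k \<in> {..<N * m}"
    then have n: "\<nu> (k div m) \<in> lattice_nodes D M"
      using bij dm by (auto simp: bij_betw_def)
    show "\<mu> k \<in> lattice_nodes (Suc D) M"
      unfolding lattice_nodes_def
    proof (rule PiE_I)
      fix d assume "d \<in> {1..Suc D}"
      then show "\<mu> k d \<in> {..<M d}"
        using n m by (cases "d = Suc D") (auto simp: \<mu>_def lattice_nodes_def m_def PiE_iff)
    next
      fix d assume "d \<notin> {1..Suc D}"
      then show "\<mu> k d = undefined"
        using n by (auto simp: \<mu>_def lattice_nodes_def PiE_iff extensional_def)
    qed
  next
    fix x assume x: "x \<in> lattice_nodes (Suc D) M"
    have "x(Suc D := undefined) \<in> lattice_nodes D M"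
      using x by (auto simp: lattice_nodes_def PiE_iff extensional_def)
    then obtain k where k: "k < N" "\<nu> k = x(Suc D := undefined)"
      using bij by (metis bij_betw_def imageE lessThan_iff)
    have xm: "x (Suc D) < m" using x by (auto simp: lattice_nodes_def m_def PiE_iff)
    have "k * m + x (Suc D) < N * m"
    proof -
      have "k * m + x (Suc D) < Suc k * m" using xm by simp
      also have "\<dots> \<le> N * m" using k by (intro mult_le_mono1) simp
      finally show ?thesis .
    qed
    moreover have "\<mu> (k * m + x (Suc D)) = x" using k xm by (auto simp: \<mu>_def)
    ultimately show "\<exists>k\<in>{..<N * m}. x = \<mu> k" by (metis lessThan_iff)
  qed
  moreover have "kronecker_prod X (Suc D) $$ (k, l) = (\<Prod>d=1..Suc D. X d $$ (\<mu> k d, \<mu> l d))"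
    if X: "\<forall>d\<in>{1..Suc D}. X d \<in> carrier_mat (M d) (M d)" and "k < N * m" "l < N * m"
    for X :: "nat \<Rightarrow> real mat" and k l
  proof -
    have c: "kronecker_prod X D \<in> carrier_mat N N"
      using dim_kronecker_prod[of D X M] X by (auto simp: N_def)
    have d: "X (Suc D) \<in> carrier_mat m m" using X by (auto simp: m_def)
    have "(\<Prod>d=1..D. X d $$ (\<mu> k d, \<mu> l d)) =
          (\<Prod>d=1..D. X d $$ (\<nu> (k div m) d, \<nu> (l div m) d))"
      by (rule prod.cong) (auto simp: \<mu>_def)
    then show ?thesis
      using c d that ent[of X "k div m" "l div m"] dm
      by (auto simp: kronecker_def \<mu>_def)
  qed
  ultimately show ?case unfolding NS by blast
qed

lemma lattice_links_along_iff:
  "{x, y} \<in> lattice_links_along D M j \<longleftrightarrow>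
     x \<in> lattice_nodes D M \<and> y \<in> lattice_nodes D M \<and> {e \<in> {1..D}. x e \<noteq> y e} = {j}"
proof
  have s: "{e \<in> {1..D}. y e \<noteq> x e} = {e \<in> {1..D}. x e \<noteq> y e}" by auto
  assume "{x, y} \<in> lattice_links_along D M j"
  then obtain u v where "{x, y} = {u, v}" and uv: "u \<in> lattice_nodes D M"
    "v \<in> lattice_nodes D M" "{e \<in> {1..D}. u e \<noteq> v e} = {j}"
    unfolding lattice_links_along_def by blast
  then have "u = x \<and> v = y \<or> u = y \<and> v = x" by (auto simp: doubleton_eq_iff)
  then show "x \<in> lattice_nodes D M \<and> y \<in> lattice_nodes D M \<and>
      {e \<in> {1..D}. x e \<noteq> y e} = {j}"
    using uv s by (elim disjE conjE) (hypsubst, simp only: simp_thms)+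
qed (unfold lattice_links_along_def, blast)

lemma lattice_ordering_exists:
  assumes "\<forall>d\<in>{1..D}. 0 < M d"
  shows "\<exists>\<nu>. lattice_ordering D M \<nu>"
proof -
  define N where "N = (\<Prod>d=1..D. M d)"
  obtain \<nu> where bij: "bij_betw \<nu> {..<N} (lattice_nodes D M)"
    and ent: "\<And>X::nat \<Rightarrow> real mat. \<And>k l. (\<forall>d\<in>{1..D}. X d \<in> carrier_mat (M d) (M d)) \<Longrightarrow>
        k < N \<Longrightarrow> l < N \<Longrightarrow> kronecker_prod X D $$ (k, l) = (\<Prod>d=1..D. X d $$ (\<nu> k d, \<nu> l d))"
    using ordering_aux[OF assms] unfolding N_def by auto
  have "adjacency_mat N \<nu> (lattice_links_along D M j) =
        (kronecker_prod (\<lambda>d. if d = j then complete_mat (M d) else 1\<^sub>m (M d)) D :: real mat)"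
    (is "?A = kronecker_prod ?X D") if j: "j \<in> {1..D}" for j
  proof (rule eq_matI)
    have X: "\<forall>d\<in>{1..D}. ?X d \<in> carrier_mat (M d) (M d)" by (auto simp: complete_mat_def)
    have c: "kronecker_prod ?X D \<in> carrier_mat N N"
      using dim_kronecker_prod[of D ?X M] X by (auto simp: N_def)
    show "dim_row ?A = dim_row (kronecker_prod ?X D)" "dim_col ?A = dim_col (kronecker_prod ?X D)"
      using c by (auto simp: adjacency_mat_def)
    fix k l assume "k < dim_row (kronecker_prod ?X D)" "l < dim_col (kronecker_prod ?X D)"
    then have kl: "k < N" "l < N" using c by auto
    have n: "\<nu> k \<in> lattice_nodes D M" "\<nu> l \<in> lattice_nodes D M"
      using bij kl by (auto simp: bij_betw_def)
    have lt: "\<nu> k d < M d" "\<nu> l d < M d" if "d \<in> {1..D}" for d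
      using n that by (auto simp: lattice_nodes_def PiE_iff)
    have e: "?X d $$ (\<nu> k d, \<nu> l d) = (if (d = j) = (\<nu> k d \<noteq> \<nu> l d) then 1 else 0)"
      if "d \<in> {1..D}" for d
      using lt[OF that] by (auto simp: complete_mat_def)
    have "kronecker_prod ?X D $$ (k, l) =
        (\<Prod>d=1..D. if (d = j) = (\<nu> k d \<noteq> \<nu> l d) then 1 else 0)"
      unfolding ent[OF X kl] by (rule prod.cong[OF refl e])
    also have "\<dots> = (if {e \<in> {1..D}. \<nu> k e \<noteq> \<nu> l e} = {j} then 1 else 0)"
    proof (cases "{e \<in> {1..D}. \<nu> k e \<noteq> \<nu> l e} = {j}")
      case True
      then have "\<forall>d\<in>{1..D}. (d = j) = (\<nu> k d \<noteq> \<nu> l d)" by blast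
      with True show ?thesis by simp
    next
      case False
      then have "\<exists>d\<in>{1..D}. (d = j) \<noteq> (\<nu> k d \<noteq> \<nu> l d)" using j by blast
      with False show ?thesis by auto
    qed
    also have "\<dots> = ?A $$ (k, l)"
      using kl n by (simp add: adjacency_mat_def lattice_links_along_iff)
    finally show "?A $$ (k, l) = kronecker_prod ?X D $$ (k, l)" by simp
  qed
  then show ?thesis using bij unfolding lattice_ordering_def N_def by blast
qed

end

theory Submission
  imports Defs "Jordan_Normal_Form.Determinant"
begin

text \<open>For fixed \<open>z\<close> off the real axis the K1 equation has at most one solution whose entries have
  imaginary parts of the sign of \<open>Im z\<close>. Exchanging two symbols in every coordinate is an
  automorphism of the lattice that preserves the dimension of each link, hence the means and
  variances of \<open>W\<close>, and such automorphisms act transitively on the nodes; by uniqueness all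
  \<open>C k k\<close> are equal to one number \<open>m\<close>. The matrix inverted in the K1 equation is therefore
  \<open>E[W] - z - \<sigma> m\<close> with a scalar \<open>\<sigma>\<close>, and is diagonalized by the tensor products of the
  eigenprojections of the matrices \<open>K\<close>. Expanding these projections in tensor products of \<open>K\<close> and
  \<open>I\<close> defines \<open>\<alpha>\<close>; only the product of identities has a nonzero diagonal, so its coefficient
  is \<open>m\<close>.\<close>

section \<open>Uniqueness for the K1 equation\<close>

text \<open>The matrix inverted in the K1 equation at one fixed \<open>z\<close>, with mean
  \<open>b\<close>, variances \<open>s\<close> and diagonal unknowns \<open>c\<close>. It lives on
  an arbitrary index set, so that an automorphism acts on it by reindexing sums.\<close>

definition K1_operator ::
    "'a set \<Rightarrow> ('a \<Rightarrow> 'a \<Rightarrow> complex) \<Rightarrow> ('a \<Rightarrow> 'a \<Rightarrow> real) \<Rightarrow> complex \<Rightarrow> ('a \<Rightarrow> complex) \<Rightarrow> 'a \<Rightarrow> 'a \<Rightarrow> complex"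
  where "K1_operator I b s z c i j =
    b i j - (if i = j then z + (\<Sum>t\<in>I. complex_of_real (s i t) * c t) else 0)"

text \<open>Two-sided, since the resolvent identity uses a left inverse of one matrix and a right
  inverse of the other, and a matrix may take either role.\<close>

definition inverse_on :: "'a set \<Rightarrow> ('a \<Rightarrow> 'a \<Rightarrow> 'b::semiring_1) \<Rightarrow> ('a \<Rightarrow> 'a \<Rightarrow> 'b) \<Rightarrow> bool" where
  "inverse_on I A C \<longleftrightarrow>
     (\<forall>i\<in>I. \<forall>k\<in>I. (\<Sum>j\<in>I. A i j * C j k) = of_bool (i = k)) \<and>
     (\<forall>i\<in>I. \<forall>k\<in>I. (\<Sum>j\<in>I. C i j * A j k) = of_bool (i = k))"

lemma inverse_on_cong:
  assumes "inverse_on I A C" and "\<And>i j. i \<in> I \<Longrightarrow> j \<in> I \<Longrightarrow> A' i j = A i j"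
  shows "inverse_on I A' C"
  using assms by (simp add: inverse_on_def)

text \<open>This is \<open>C' - C = C (A - A') C'\<close>, from \<open>C A = 1\<close> and
  \<open>A' C' = 1\<close>, when the matrices differ only on the diagonal. It serves for a matrix
  and its adjoint, for two solutions of the K1 equation, and with \<open>\<delta> = 0\<close> for
  uniqueness of inverses.\<close>

lemma resolvent_identity:
  fixes A A' C C' :: "'a \<Rightarrow> 'a \<Rightarrow> 'b::comm_ring_1"
  assumes I: "finite I" and k: "k \<in> I" and l: "l \<in> I"
    and C: "inverse_on I A C" and C': "inverse_on I A' C'"
    and diag: "\<And>i j. i \<in> I \<Longrightarrow> j \<in> I \<Longrightarrow> A i j - A' i j = (if i = j then \<delta> i else 0)"
  shows "C' k l - C k l = (\<Sum>i\<in>I. C k i * \<delta> i * C' i l)"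
proof -
  have "(\<Sum>i\<in>I. C k i * \<delta> i * C' i l) = (\<Sum>i\<in>I. \<Sum>j\<in>I. C k i * (A i j - A' i j) * C' j l)"
  proof (rule sum.cong[OF refl])
    fix i assume i: "i \<in> I"
    have "(\<Sum>j\<in>I. C k i * (A i j - A' i j) * C' j l) =
        (\<Sum>j\<in>I. if i = j then C k i * \<delta> i * C' i l else 0)"
      using i by (intro sum.cong) (auto simp: diag)
    then show "C k i * \<delta> i * C' i l = (\<Sum>j\<in>I. C k i * (A i j - A' i j) * C' j l)"
      using I i by simp
  qed
  also have "\<dots> = (\<Sum>i\<in>I. \<Sum>j\<in>I. C k i * A i j * C' j l) - (\<Sum>i\<in>I. C k i * (\<Sum>j\<in>I. A' i j * C' j l))"
    by (simp add: sum_subtractf right_diff_distrib left_diff_distrib sum_distrib_left mult.assoc)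
  also have "(\<Sum>i\<in>I. \<Sum>j\<in>I. C k i * A i j * C' j l) = (\<Sum>j\<in>I. (\<Sum>i\<in>I. C k i * A i j) * C' j l)"
    by (subst sum.swap) (simp add: sum_distrib_right)
  also have "\<dots> = (\<Sum>j\<in>I. if k = j then C' j l else 0)"
    using C k by (intro sum.cong) (auto simp: inverse_on_def)
  also have "\<dots> = C' k l" using I k by simp
  also have "(\<Sum>i\<in>I. C k i * (\<Sum>j\<in>I. A' i j * C' j l)) = (\<Sum>i\<in>I. if i = l then C k i else 0)"
    using C' l by (intro sum.cong) (auto simp: inverse_on_def)
  also have "\<dots> = C k l" using I l by simp
  finally show ?thesis by simp
qed

lemma inverse_on_adjoint:
  fixes A C :: "'a \<Rightarrow> 'a \<Rightarrow> complex"
  assumes "inverse_on I A C"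
  shows "inverse_on I (\<lambda>i j. cnj (A j i)) (\<lambda>i j. cnj (C j i))"
proof -
  have "(\<Sum>j\<in>I. cnj (A j i) * cnj (C k j)) = of_bool (i = k)" if "i \<in> I" "k \<in> I" for i k
  proof -
    have "(\<Sum>j\<in>I. cnj (A j i) * cnj (C k j)) = cnj (\<Sum>j\<in>I. C k j * A j i)"
      by (simp add: mult.commute)
    also have "(\<Sum>j\<in>I. C k j * A j i) = of_bool (k = i)"
      using assms that by (simp add: inverse_on_def)
    finally show ?thesis by (cases "i = k") simp_all
  qed
  moreover have "(\<Sum>j\<in>I. cnj (C j i) * cnj (A k j)) = of_bool (i = k)" if "i \<in> I" "k \<in> I" for i k
  proof -
    have "(\<Sum>j\<in>I. cnj (C j i) * cnj (A k j)) = cnj (\<Sum>j\<in>I. A k j * C j i)"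
      by (simp add: mult.commute)
    also have "(\<Sum>j\<in>I. A k j * C j i) = of_bool (k = i)"
      using assms that by (simp add: inverse_on_def)
    finally show ?thesis by (cases "i = k") simp_all
  qed
  ultimately show ?thesis by (simp add: inverse_on_def)
qed

text \<open>The Hermitian part \<open>b\<close> cancels and \<open>s\<close> is real, so only the
  imaginary part of the diagonal term survives.\<close>

lemma K1_operator_minus_adjoint:
  assumes "\<And>i j. i \<in> I \<Longrightarrow> j \<in> I \<Longrightarrow> b i j = cnj (b j i)" and "i \<in> I" "j \<in> I"
  shows "K1_operator I b s z c i j - cnj (K1_operator I b s z c j i) =
    (if i = j then - 2 * \<i> * complex_of_real (Im z + (\<Sum>t\<in>I. s i t * Im (c t))) else 0)"
proof (cases "i = j")
  case True
  have "Im (b i i) = - Im (b i i)"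
    using arg_cong[OF assms(1)[OF assms(2,2)], of Im] by simp
  then have "Im (b i i) = 0" by simp
  then have "Im (K1_operator I b s z c i i) = - (Im z + (\<Sum>t\<in>I. s i t * Im (c t)))"
    by (simp add: K1_operator_def)
  moreover have "K1_operator I b s z c i i - cnj (K1_operator I b s z c i i) =
      2 * \<i> * complex_of_real (Im (K1_operator I b s z c i i))"
    by (simp add: complex_eq_iff)
  ultimately show ?thesis using True
    by (simp only: simp_thms if_True of_real_minus mult_minus_left mult_minus_right)
next
  case False
  then show ?thesis using assms(1)[OF assms(2,3)] by (simp add: K1_operator_def)
qed

lemma mult_cnj_weighted:
  "a * (w * complex_of_real e) * cnj a = w * complex_of_real ((cmod a)\<^sup>2 * e)"
  by (simp only: of_real_mult complex_norm_square ac_simps)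

lemma Im_eqI: "w - cnj w = 2 * \<i> * complex_of_real x \<Longrightarrow> Im w = x"
  by (simp add: complex_eq_iff)

text \<open>The resolvent identity for the matrix and its adjoint, whose difference is diagonal and
  imaginary. Taking the two in either order puts the weights on row \<open>k\<close> or on column
  \<open>k\<close> of \<open>C\<close>.\<close>

lemma Im_inverse_K1_operator:
  assumes I: "finite I" and k: "k \<in> I"
    and herm: "\<And>i j. i \<in> I \<Longrightarrow> j \<in> I \<Longrightarrow> b i j = cnj (b j i)"
    and C: "inverse_on I (K1_operator I b s z c) C"
  shows "Im (C k k) = (\<Sum>i\<in>I. (cmod (C k i))\<^sup>2 * (Im z + (\<Sum>t\<in>I. s i t * Im (c t))))"
    and "Im (C k k) = (\<Sum>i\<in>I. (cmod (C i k))\<^sup>2 * (Im z + (\<Sum>t\<in>I. s i t * Im (c t))))"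
proof -
  let ?A = "K1_operator I b s z c"
  let ?e = "\<lambda>i. Im z + (\<Sum>t\<in>I. s i t * Im (c t))"
  have "cnj (C k k) - C k k = (\<Sum>i\<in>I. C k i * (- 2 * \<i> * complex_of_real (?e i)) * cnj (C k i))"
    by (rule resolvent_identity[OF I k k C inverse_on_adjoint[OF C]
          K1_operator_minus_adjoint[OF herm]])
  also have "\<dots> = - 2 * \<i> * complex_of_real (\<Sum>i\<in>I. (cmod (C k i))\<^sup>2 * ?e i)"
    by (simp only: mult_cnj_weighted of_real_sum sum_distrib_left)
  finally have "C k k - cnj (C k k) = - (- 2 * \<i> * complex_of_real (\<Sum>i\<in>I. (cmod (C k i))\<^sup>2 * ?e i))"
    by (metis minus_diff_eq)
  then show "Im (C k k) = (\<Sum>i\<in>I. (cmod (C k i))\<^sup>2 * ?e i)"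
    by (intro Im_eqI) (simp only: mult_minus_left minus_minus)
  have swap: "a * w * b = b * w * a" for a b w :: complex by simp
  have "C k k - cnj (C k k) = (\<Sum>i\<in>I. cnj (C i k) * (2 * \<i> * complex_of_real (?e i)) * C i k)"
  proof (rule resolvent_identity[OF I k k inverse_on_adjoint[OF C] C])
    fix i j assume ij: "i \<in> I" "j \<in> I"
    have "cnj (?A j i) - ?A i j = - (?A i j - cnj (?A j i))" by (rule minus_diff_eq[symmetric])
    also have "\<dots> = - (if i = j then - 2 * \<i> * complex_of_real (?e i) else 0)"
      by (subst K1_operator_minus_adjoint[OF herm]) (use ij in auto)
    finally show "cnj (?A j i) - ?A i j = (if i = j then 2 * \<i> * complex_of_real (?e i) else 0)"
      by simp
  qed
  also have "\<dots> = (\<Sum>i\<in>I. C i k * (2 * \<i> * complex_of_real (?e i)) * cnj (C i k))"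
    by (intro sum.cong refl) (rule swap)
  also have "\<dots> = 2 * \<i> * complex_of_real (\<Sum>i\<in>I. (cmod (C i k))\<^sup>2 * ?e i)"
    by (simp only: mult_cnj_weighted of_real_sum sum_distrib_left)
  finally show "Im (C k k) = (\<Sum>i\<in>I. (cmod (C i k))\<^sup>2 * ?e i)"
    by (rule Im_eqI)
qed

text \<open>The imaginary part of the equation shows that \<open>v = \<bar>Im c\<bar>\<close> satisfies \<open>R s v < v\<close>, both
  for \<open>R k i = \<bar>C k i\<bar>\<^sup>2\<close> and for \<open>R k i = \<bar>C i k\<bar>\<^sup>2\<close>. By the resolvent identity and the
  Cauchy-Schwarz inequality a nonzero difference of two solutions would then be strictly smaller
  than itself in the maximum norm weighted with \<open>u = sqrt (v * v')\<close>.\<close>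

lemma K1_unique:
  assumes I: "finite I"
    and herm: "\<And>i j. i \<in> I \<Longrightarrow> j \<in> I \<Longrightarrow> b i j = cnj (b j i)"
    and s: "\<And>i j. i \<in> I \<Longrightarrow> j \<in> I \<Longrightarrow> 0 \<le> s i j"
    and C: "inverse_on I (K1_operator I b s z c) C" "\<And>k. k \<in> I \<Longrightarrow> C k k = c k"
      "\<And>k. k \<in> I \<Longrightarrow> 0 < Im z * Im (c k)"
    and C': "inverse_on I (K1_operator I b s z c') C'" "\<And>k. k \<in> I \<Longrightarrow> C' k k = c' k"
      "\<And>k. k \<in> I \<Longrightarrow> 0 < Im z * Im (c' k)"
    and k: "k \<in> I"
  shows "c k = c' k"
proof -
  define v where "v = (\<lambda>k. \<bar>Im (c k)\<bar>)"
  define v' where "v' = (\<lambda>k. \<bar>Im (c' k)\<bar>)"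
  define u where "u = (\<lambda>k. sqrt (v k * v' k))"
  have pos: "0 < v k" "0 < v' k" "0 < u k" if "k \<in> I" for k
  proof -
    have "Im (c k) \<noteq> 0" "Im (c' k) \<noteq> 0" using C(3)[OF that] C'(3)[OF that] by auto
    then show "0 < v k" "0 < v' k" by (simp_all add: v_def v'_def)
    then show "0 < u k" by (simp add: u_def)
  qed
  \<comment> \<open>The factor \<open>sgn (Im z)\<close> treats both half planes at once.\<close>
  have sv: "sgn (Im z) * Im (c k) = v k" "sgn (Im z) * Im (c' k) = v' k" if "k \<in> I" for k
    using C(3)[OF that] C'(3)[OF that]
    by (auto simp: v_def v'_def sgn_if zero_less_mult_iff split: if_splits)
  have z: "Im z \<noteq> 0" using C(3)[OF k] by auto
  have sgn_e: "sgn (Im z) * (Im z + (\<Sum>t\<in>I. s i t * Im (c t))) = \<bar>Im z\<bar> + (\<Sum>t\<in>I. s i t * v t)"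
    "sgn (Im z) * (Im z + (\<Sum>t\<in>I. s i t * Im (c' t))) = \<bar>Im z\<bar> + (\<Sum>t\<in>I. s i t * v' t)" for i
  proof -
    have "sgn (Im z) * Im z = \<bar>Im z\<bar>" by (simp add: sgn_if abs_if)
    then show "sgn (Im z) * (Im z + (\<Sum>t\<in>I. s i t * Im (c t))) = \<bar>Im z\<bar> + (\<Sum>t\<in>I. s i t * v t)"
      "sgn (Im z) * (Im z + (\<Sum>t\<in>I. s i t * Im (c' t))) = \<bar>Im z\<bar> + (\<Sum>t\<in>I. s i t * v' t)"
      by (simp_all add: distrib_left sum_distrib_left mult.left_commute[of "sgn (Im z)"] sv)
  qed
  have row: "L2_set (\<lambda>(i, j). cmod (C k i) * sqrt (s i j * v j)) (I \<times> I) < sqrt (v k)"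
    if k: "k \<in> I" for k
  proof -
    \<comment> \<open>A zero row cannot occur in a left inverse. A nonzero entry makes the term with
      \<open>\<bar>Im z\<bar>\<close> positive, hence the bound strict.\<close>
    have "\<exists>i\<in>I. C k i \<noteq> 0"
    proof (rule ccontr)
      assume "\<not> ?thesis"
      then have "(\<Sum>j\<in>I. C k j * K1_operator I b s z c j k) = 0" by simp
      then show False using C(1) k by (simp add: inverse_on_def)
    qed
    then have p: "0 < (\<Sum>i\<in>I. (cmod (C k i))\<^sup>2)"
      using I by (auto intro!: sum_pos2)
    have "v k = sgn (Im z) * (\<Sum>i\<in>I. (cmod (C k i))\<^sup>2 * (Im z + (\<Sum>t\<in>I. s i t * Im (c t))))"
      using Im_inverse_K1_operator(1)[OF I k herm C(1)] C(2)[OF k] sv(1)[OF k] by simp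
    also have "\<dots> = (\<Sum>i\<in>I. (cmod (C k i))\<^sup>2 * (\<bar>Im z\<bar> + (\<Sum>t\<in>I. s i t * v t)))"
      by (simp add: sum_distrib_left[of "sgn (Im z)"] mult.left_commute[of "sgn (Im z)"] sgn_e)
    also have "\<dots> = \<bar>Im z\<bar> * (\<Sum>i\<in>I. (cmod (C k i))\<^sup>2) +
        (\<Sum>(i, j)\<in>I \<times> I. (cmod (C k i))\<^sup>2 * (s i j * v j))"
      by (simp only: distrib_left sum.distrib sum.cartesian_product[symmetric] sum_distrib_left[symmetric])
         (simp add: sum_distrib_left[of "\<bar>Im z\<bar>"] mult.commute)
    finally have "(\<Sum>(i, j)\<in>I \<times> I. (cmod (C k i))\<^sup>2 * (s i j * v j)) < v k"
      using p z by simp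
    moreover have "(\<Sum>(i, j)\<in>I \<times> I. (cmod (C k i))\<^sup>2 * (s i j * v j)) =
        (\<Sum>x\<in>I \<times> I. ((\<lambda>(i, j). cmod (C k i) * sqrt (s i j * v j)) x)\<^sup>2)"
      using s pos(1) by (intro sum.cong) (auto simp: power_mult_distrib less_imp_le)
    ultimately show ?thesis by (simp add: L2_set_def)
  qed
  \<comment> \<open>A weak bound is enough here: together with the strict one for the rows it makes
    the product of the two norms smaller than \<open>u m\<close>.\<close>
  have col: "L2_set (\<lambda>(i, j). cmod (C' i k) * sqrt (s i j * v' j)) (I \<times> I) \<le> sqrt (v' k)"
    if k: "k \<in> I" for k
  proof -
    have "v' k = sgn (Im z) * (\<Sum>i\<in>I. (cmod (C' i k))\<^sup>2 * (Im z + (\<Sum>t\<in>I. s i t * Im (c' t))))"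
      using Im_inverse_K1_operator(2)[OF I k herm C'(1)] C'(2)[OF k] sv(2)[OF k] by simp
    also have "\<dots> = (\<Sum>i\<in>I. (cmod (C' i k))\<^sup>2 * (\<bar>Im z\<bar> + (\<Sum>t\<in>I. s i t * v' t)))"
      by (simp add: sum_distrib_left[of "sgn (Im z)"] mult.left_commute[of "sgn (Im z)"] sgn_e)
    also have "\<dots> = \<bar>Im z\<bar> * (\<Sum>i\<in>I. (cmod (C' i k))\<^sup>2) +
        (\<Sum>(i, j)\<in>I \<times> I. (cmod (C' i k))\<^sup>2 * (s i j * v' j))"
      by (simp only: distrib_left sum.distrib sum.cartesian_product[symmetric] sum_distrib_left[symmetric])
         (simp add: sum_distrib_left[of "\<bar>Im z\<bar>"] mult.commute)
    finally have "(\<Sum>(i, j)\<in>I \<times> I. (cmod (C' i k))\<^sup>2 * (s i j * v' j)) \<le> v' k"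
      by (simp add: sum_nonneg)
    moreover have "(\<Sum>(i, j)\<in>I \<times> I. (cmod (C' i k))\<^sup>2 * (s i j * v' j)) =
        (\<Sum>x\<in>I \<times> I. ((\<lambda>(i, j). cmod (C' i k) * sqrt (s i j * v' j)) x)\<^sup>2)"
      using s pos(2) by (intro sum.cong) (auto simp: power_mult_distrib less_imp_le)
    ultimately show ?thesis by (simp add: L2_set_def)
  qed
  define r where "r = (\<lambda>k. cmod (c' k - c k) / u k)"
  have "Max (r ` I) \<in> r ` I" using I k by (intro Max_in) auto
  then obtain m where m: "m \<in> I" "r m = Max (r ` I)" by auto
  have r_le: "r i \<le> r m" if "i \<in> I" for i using m that I by simp
  have d_le: "cmod (c' i - c i) \<le> r m * u i" if "i \<in> I" for i
    using r_le[OF that] pos(3)[OF that] by (simp add: r_def field_simps)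
  \<comment> \<open>The two inverted matrices differ only in the diagonal sums over \<open>c\<close>
    and \<open>c'\<close>, so the difference at the maximizing index \<open>m\<close> is controlled
    by the differences at all indices.\<close>
  have "c' m - c m = (\<Sum>i\<in>I. C m i * (\<Sum>t\<in>I. complex_of_real (s i t) * (c' t - c t)) * C' i m)"
    unfolding C(2)[OF m(1), symmetric] C'(2)[OF m(1), symmetric]
    by (rule resolvent_identity[OF I m(1) m(1) C(1) C'(1)])
       (simp add: K1_operator_def sum_subtractf right_diff_distrib)
  then have "cmod (c' m - c m) \<le>
      (\<Sum>i\<in>I. cmod (C m i * (\<Sum>t\<in>I. complex_of_real (s i t) * (c' t - c t)) * C' i m))"
    by (simp add: norm_sum)
  also have "\<dots> \<le> (\<Sum>i\<in>I. \<Sum>j\<in>I. r m * (cmod (C m i) * sqrt (s i j * v j) * (cmod (C' i m) * sqrt (s i j * v' j))))"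
  proof (rule sum_mono)
    fix i assume i: "i \<in> I"
    have "cmod (\<Sum>t\<in>I. complex_of_real (s i t) * (c' t - c t)) \<le> (\<Sum>t\<in>I. s i t * (r m * u t))"
      using s[OF i] d_le by (intro sum_norm_le) (auto simp: norm_mult intro!: mult_left_mono)
    then have "cmod (C m i * (\<Sum>t\<in>I. complex_of_real (s i t) * (c' t - c t)) * C' i m) \<le>
        cmod (C m i) * (\<Sum>t\<in>I. s i t * (r m * u t)) * cmod (C' i m)"
      by (simp add: norm_mult mult_left_mono mult_right_mono)
    also have "\<dots> = (\<Sum>j\<in>I. cmod (C m i) * (s i j * (r m * u j)) * cmod (C' i m))"
      by (simp add: sum_distrib_left sum_distrib_right)
    also have "\<dots> = (\<Sum>j\<in>I. r m * (cmod (C m i) * sqrt (s i j * v j) * (cmod (C' i m) * sqrt (s i j * v' j))))"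
    proof (rule sum.cong[OF refl])
      fix j assume j: "j \<in> I"
      \<comment> \<open>Splitting \<open>s i j * u j\<close> into a root with \<open>v\<close> and a
        root with \<open>v'\<close> lets Cauchy-Schwarz separate row \<open>m\<close> of
        \<open>C\<close> from column \<open>m\<close> of \<open>C'\<close>.\<close>
      have "sqrt (s i j * v j) * sqrt (s i j * v' j) = sqrt ((s i j * s i j) * (v j * v' j))"
        by (simp only: real_sqrt_mult[symmetric] ac_simps)
      also have "\<dots> = s i j * u j"
        using s[OF i j] by (simp add: real_sqrt_mult[of "s i j * s i j"] u_def)
      finally have e: "sqrt (s i j * v j) * sqrt (s i j * v' j) = s i j * u j" .
      have "cmod (C m i) * (s i j * (r m * u j)) * cmod (C' i m) =
          r m * (cmod (C m i) * cmod (C' i m) * (s i j * u j))"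
        by (simp only: ac_simps)
      also have "\<dots> = r m * (cmod (C m i) * sqrt (s i j * v j) * (cmod (C' i m) * sqrt (s i j * v' j)))"
        unfolding e[symmetric] by (simp only: ac_simps)
      finally show "cmod (C m i) * (s i j * (r m * u j)) * cmod (C' i m) = \<dots>" .
    qed
    finally show "cmod (C m i * (\<Sum>t\<in>I. complex_of_real (s i t) * (c' t - c t)) * C' i m) \<le> \<dots>" .
  qed
  also have "\<dots> = r m * (\<Sum>x\<in>I \<times> I. \<bar>(\<lambda>(i, j). cmod (C m i) * sqrt (s i j * v j)) x\<bar> *
      \<bar>(\<lambda>(i, j). cmod (C' i m) * sqrt (s i j * v' j)) x\<bar>)"
    using s pos by (auto simp: sum.cartesian_product sum_distrib_left less_imp_le intro!: sum.cong)
  also have "\<dots> \<le> r m * (L2_set (\<lambda>(i, j). cmod (C m i) * sqrt (s i j * v j)) (I \<times> I) *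
      L2_set (\<lambda>(i, j). cmod (C' i m) * sqrt (s i j * v' j)) (I \<times> I))"
    using pos(3)[OF m(1)] by (intro mult_left_mono L2_set_mult_ineq) (simp add: r_def)
  finally have le: "r m * u m \<le> r m * (L2_set (\<lambda>(i, j). cmod (C m i) * sqrt (s i j * v j)) (I \<times> I) *
      L2_set (\<lambda>(i, j). cmod (C' i m) * sqrt (s i j * v' j)) (I \<times> I))"
    using pos(3)[OF m(1)] by (simp add: r_def)
  have lt: "L2_set (\<lambda>(i, j). cmod (C m i) * sqrt (s i j * v j)) (I \<times> I) *
      L2_set (\<lambda>(i, j). cmod (C' i m) * sqrt (s i j * v' j)) (I \<times> I) < u m"
    (is "?L * ?L' < _")
  proof (rule le_less_trans)
    show "?L * ?L' \<le> ?L * sqrt (v' m)"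
      using col[OF m(1)] by (intro mult_left_mono L2_set_nonneg)
    show "?L * sqrt (v' m) < u m"
      using row[OF m(1)] pos(2)[OF m(1)] by (simp add: u_def real_sqrt_mult[of "v m"])
  qed
  \<comment> \<open>\<open>r m * u m\<close> is at most \<open>r m\<close> times a number smaller
    than \<open>u m\<close>, which excludes a positive \<open>r m\<close>.\<close>
  have "r m \<le> 0"
    using le lt by (meson mult_less_cancel_left_pos not_le)
  then have "cmod (c' k - c k) \<le> 0"
    using d_le[OF k] pos(3)[OF k] by (smt (verit) mult_nonpos_nonneg)
  then show ?thesis by simp
qed

text \<open>Relabelling by \<open>\<tau>\<close> keeps \<open>b\<close> and \<open>s\<close>, so
  \<open>c \<circ> \<tau>\<close> solves the same equation, with the permuted \<open>C\<close> as
  inverse; uniqueness forces equality.\<close>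

lemma K1_solution_automorphism:
  assumes I: "finite I" and \<tau>: "bij_betw \<tau> I I"
    and b: "\<And>i j. i \<in> I \<Longrightarrow> j \<in> I \<Longrightarrow> b (\<tau> i) (\<tau> j) = b i j"
    and s: "\<And>i j. i \<in> I \<Longrightarrow> j \<in> I \<Longrightarrow> s (\<tau> i) (\<tau> j) = s i j"
    and herm: "\<And>i j. i \<in> I \<Longrightarrow> j \<in> I \<Longrightarrow> b i j = cnj (b j i)"
    and nonneg: "\<And>i j. i \<in> I \<Longrightarrow> j \<in> I \<Longrightarrow> 0 \<le> s i j"
    and C: "inverse_on I (K1_operator I b s z c) C" "\<And>k. k \<in> I \<Longrightarrow> C k k = c k"
      "\<And>k. k \<in> I \<Longrightarrow> 0 < Im z * Im (c k)"
    and k: "k \<in> I"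
  shows "c (\<tau> k) = c k"
proof -
  have \<tau>I: "\<tau> i \<in> I" if "i \<in> I" for i using \<tau> that by (auto simp: bij_betw_def)
  have inj: "\<tau> i = \<tau> j \<longleftrightarrow> i = j" if "i \<in> I" "j \<in> I" for i j
    using \<tau> that by (auto simp: bij_betw_def inj_on_def)
  have op: "K1_operator I b s z (c \<circ> \<tau>) i j = K1_operator I b s z c (\<tau> i) (\<tau> j)"
    if "i \<in> I" "j \<in> I" for i j
  proof -
    have "(\<Sum>t\<in>I. complex_of_real (s i t) * c (\<tau> t)) = (\<Sum>t\<in>I. complex_of_real (s (\<tau> i) (\<tau> t)) * c (\<tau> t))"
      using s that by simp
    also have "\<dots> = (\<Sum>t\<in>I. complex_of_real (s (\<tau> i) t) * c t)"
      by (rule sum.reindex_bij_betw[OF \<tau>])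
    finally show ?thesis using that by (cases "i = j") (simp_all add: K1_operator_def b inj)
  qed
  have "inverse_on I (K1_operator I b s z (c \<circ> \<tau>)) (\<lambda>i j. C (\<tau> i) (\<tau> j))"
    unfolding inverse_on_def
  proof (intro conjI ballI)
    fix i k assume i: "i \<in> I" and k: "k \<in> I"
    have "(\<Sum>j\<in>I. K1_operator I b s z (c \<circ> \<tau>) i j * C (\<tau> j) (\<tau> k)) =
        (\<Sum>j\<in>I. K1_operator I b s z c (\<tau> i) (\<tau> j) * C (\<tau> j) (\<tau> k))"
      using i by (simp add: op)
    also have "\<dots> = (\<Sum>j\<in>I. K1_operator I b s z c (\<tau> i) j * C j (\<tau> k))"
      by (rule sum.reindex_bij_betw[OF \<tau>])
    finally show "(\<Sum>j\<in>I. K1_operator I b s z (c \<circ> \<tau>) i j * C (\<tau> j) (\<tau> k)) = of_bool (i = k)"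
      using C(1) i k \<tau>I by (simp add: inverse_on_def inj)
    have "(\<Sum>j\<in>I. C (\<tau> i) (\<tau> j) * K1_operator I b s z (c \<circ> \<tau>) j k) =
        (\<Sum>j\<in>I. C (\<tau> i) (\<tau> j) * K1_operator I b s z c (\<tau> j) (\<tau> k))"
      using k by (simp add: op)
    also have "\<dots> = (\<Sum>j\<in>I. C (\<tau> i) j * K1_operator I b s z c j (\<tau> k))"
      by (rule sum.reindex_bij_betw[OF \<tau>])
    finally show "(\<Sum>j\<in>I. C (\<tau> i) (\<tau> j) * K1_operator I b s z (c \<circ> \<tau>) j k) = of_bool (i = k)"
      using C(1) i k \<tau>I by (simp add: inverse_on_def inj)
  qed
  from K1_unique[OF I herm nonneg this _ _ C k] C(2,3) \<tau>I show ?thesis by simp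
qed

text \<open>The source of invertibility: the imaginary part of the quadratic form is minus the sum
  of the squares \<open>(cmod (x i))\<^sup>2\<close> with weights \<open>?e i\<close>, all of the
  sign of \<open>Im z\<close>, so it vanishes only at zero.\<close>

lemma K1_operator_kernel:
  assumes I: "finite I"
    and herm: "\<And>i j. i \<in> I \<Longrightarrow> j \<in> I \<Longrightarrow> b i j = cnj (b j i)"
    and s: "\<And>i j. i \<in> I \<Longrightarrow> j \<in> I \<Longrightarrow> 0 \<le> s i j"
    and c: "\<And>k. k \<in> I \<Longrightarrow> 0 < Im z * Im (c k)" and z: "Im z \<noteq> 0"
    and ker: "\<And>i. i \<in> I \<Longrightarrow> (\<Sum>j\<in>I. K1_operator I b s z c i j * x j) = 0"
    and k: "k \<in> I"
  shows "x k = 0"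
proof -
  let ?A = "K1_operator I b s z c"
  let ?e = "\<lambda>i. Im z + (\<Sum>t\<in>I. s i t * Im (c t))"
  have e: "Im z * ?e i > 0" if "i \<in> I" for i
  proof -
    have "Im z * ?e i = Im z * Im z + (\<Sum>t\<in>I. s i t * (Im z * Im (c t)))"
      by (simp add: algebra_simps sum_distrib_left)
    moreover have "0 \<le> (\<Sum>t\<in>I. s i t * (Im z * Im (c t)))"
      using s[OF that] c by (intro sum_nonneg) (simp add: less_imp_le)
    moreover have "0 < Im z * Im z" using z not_real_square_gt_zero by blast
    ultimately show ?thesis by linarith
  qed
  have q: "(\<Sum>i\<in>I. \<Sum>j\<in>I. cnj (x i) * ?A i j * x j) = 0"
    using ker by (simp add: mult.assoc flip: sum_distrib_left)
  then have "cnj (\<Sum>i\<in>I. \<Sum>j\<in>I. cnj (x i) * ?A i j * x j) = 0" by simp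
  then have "(\<Sum>i\<in>I. \<Sum>j\<in>I. x i * cnj (?A i j) * cnj (x j)) = 0" by simp
  then have "(\<Sum>i\<in>I. \<Sum>j\<in>I. cnj (x i) * cnj (?A j i) * x j) = 0"
    by (subst sum.swap) (simp add: ac_simps)
  \<comment> \<open>Subtracting the conjugate of the form leaves the anti-Hermitian part, which is
    diagonal.\<close>
  with q have q': "(\<Sum>i\<in>I. \<Sum>j\<in>I. cnj (x i) * (?A i j - cnj (?A j i)) * x j) = 0"
    by (simp add: right_diff_distrib left_diff_distrib sum_subtractf)
  have row: "(\<Sum>j\<in>I. cnj (x i) * (?A i j - cnj (?A j i)) * x j) =
      - 2 * \<i> * complex_of_real ((cmod (x i))\<^sup>2 * ?e i)" if "i \<in> I" for i
  proof -
    have "(\<Sum>j\<in>I. cnj (x i) * (?A i j - cnj (?A j i)) * x j) =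
        (\<Sum>j\<in>I. if i = j then cnj (x i) * (- 2 * \<i> * complex_of_real (?e i)) * x i else 0)"
      by (rule sum.cong[OF refl], subst K1_operator_minus_adjoint[OF herm]) (use that in auto)
    also have "\<dots> = x i * (- 2 * \<i> * complex_of_real (?e i)) * cnj (x i)"
      using I that by (simp only: sum.delta' if_True ac_simps)
    also have "\<dots> = - 2 * \<i> * complex_of_real ((cmod (x i))\<^sup>2 * ?e i)"
      by (rule mult_cnj_weighted)
    finally show ?thesis .
  qed
  have "- 2 * \<i> * complex_of_real (\<Sum>i\<in>I. (cmod (x i))\<^sup>2 * ?e i) = 0"
    unfolding q'[symmetric] of_real_sum sum_distrib_left[of "- 2 * \<i>"]
    by (rule sum.cong[OF refl row[symmetric]])
  then have "(\<Sum>i\<in>I. (cmod (x i))\<^sup>2 * ?e i) = 0" by (simp only: mult_eq_0_iff of_real_eq_0_iff) simp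
  then have "Im z * (\<Sum>i\<in>I. (cmod (x i))\<^sup>2 * ?e i) = 0" by simp
  then have "(\<Sum>i\<in>I. (cmod (x i))\<^sup>2 * (Im z * ?e i)) = 0"
    by (simp only: sum_distrib_left ac_simps)
  then have "(cmod (x k))\<^sup>2 * (Im z * ?e k) = 0"
    using e I k by (subst (asm) sum_nonneg_eq_0_iff) (auto intro!: mult_nonneg_nonneg simp: less_imp_le)
  then have "(cmod (x k))\<^sup>2 = 0"
    using e[OF k] by (metis (no_types, lifting) less_irrefl mult_eq_0_iff)
  then show ?thesis by simp
qed


section \<open>Matrices\<close>

text \<open>Reduces sums in the module of matrices to sums of entries. Closure belongs to the same
  induction because the entry formula for a sum needs matching dimensions.\<close>

lemma finsum_mat:
  fixes f :: "'b \<Rightarrow> 'a::comm_ring_1 mat"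
  assumes "finite F" and "\<And>x. x \<in> F \<Longrightarrow> f x \<in> carrier_mat nr nc"
  shows finsum_mat_closed: "finsum (module_mat TYPE('a) nr nc) f F \<in> carrier_mat nr nc"
    and index_finsum_mat: "\<lbrakk>i < nr; j < nc\<rbrakk> \<Longrightarrow>
      finsum (module_mat TYPE('a) nr nc) f F $$ (i, j) = (\<Sum>x\<in>F. f x $$ (i, j))"
proof -
  interpret M: abelian_group "module_mat TYPE('a) nr nc" by (rule abelian_group_mat)
  have "finsum (module_mat TYPE('a) nr nc) f F \<in> carrier_mat nr nc \<and>
    (\<forall>i<nr. \<forall>j<nc. finsum (module_mat TYPE('a) nr nc) f F $$ (i, j) = (\<Sum>x\<in>F. f x $$ (i, j)))"
    using assms
  proof (induction F rule: finite_induct)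
    case empty
    show ?case using M.finsum_empty[of f] by (simp add: module_mat_simps)
  next
    case (insert x F)
    have "finsum (module_mat TYPE('a) nr nc) f (insert x F) =
        f x + finsum (module_mat TYPE('a) nr nc) f F"
      using M.finsum_insert[of F x f] insert by (simp add: module_mat_simps Pi_iff)
    then show ?case using insert by (auto simp: index_add_mat(1)[of _ "finsum _ _ _"])
  qed
  then show "finsum (module_mat TYPE('a) nr nc) f F \<in> carrier_mat nr nc"
    and "\<lbrakk>i < nr; j < nc\<rbrakk> \<Longrightarrow>
      finsum (module_mat TYPE('a) nr nc) f F $$ (i, j) = (\<Sum>x\<in>F. f x $$ (i, j))"
    by auto
qed

text \<open>A trivial kernel gives a nonzero determinant and so a unit of the matrix ring; hence
  \<open>mat_inverse\<close> does not return \<open>None\<close>.\<close>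

lemma the_mat_inverse:
  fixes A :: "'a::field mat"
  assumes A: "A \<in> carrier_mat n n"
    and ker: "\<And>v. v \<in> carrier_vec n \<Longrightarrow> A *\<^sub>v v = 0\<^sub>v n \<Longrightarrow> v = 0\<^sub>v n"
  shows "the (mat_inverse A) \<in> carrier_mat n n"
    and "A * the (mat_inverse A) = 1\<^sub>m n" and "the (mat_inverse A) * A = 1\<^sub>m n"
proof -
  have "Determinant.det A \<noteq> 0"
    using det_0_iff_vec_prod_zero_field[OF A] ker by blast
  then have "A \<in> Units (ring_mat TYPE('a) n ())" by (rule det_non_zero_imp_unit[OF A])
  then obtain B where "mat_inverse A = Some B"
    using mat_inverse(1)[OF A, where b = "()"] by (cases "mat_inverse A") auto
  with mat_inverse(2)[OF A this]
  show "the (mat_inverse A) \<in> carrier_mat n n"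
    and "A * the (mat_inverse A) = 1\<^sub>m n" and "the (mat_inverse A) * A = 1\<^sub>m n"
    by simp_all
qed

lemma inverse_on_index_mat:
  fixes A C :: "'a::semiring_1 mat"
  assumes "A \<in> carrier_mat n n" "C \<in> carrier_mat n n" "A * C = 1\<^sub>m n" "C * A = 1\<^sub>m n"
  shows "inverse_on {..<n} (\<lambda>i j. A $$ (i, j)) (\<lambda>i j. C $$ (i, j))"
proof -
  have "(\<Sum>j<n. X $$ (i, j) * Y $$ (j, k)) = of_bool (i = k)"
    if "X \<in> carrier_mat n n" "Y \<in> carrier_mat n n" "X * Y = 1\<^sub>m n" "i < n" "k < n"
    for X Y :: "'a mat" and i k
  proof -
    have "(\<Sum>j<n. X $$ (i, j) * Y $$ (j, k)) = (X * Y) $$ (i, k)"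
      using that(1,2,4,5) by (simp add: scalar_prod_def lessThan_atLeast0)
    then show ?thesis using that by simp
  qed
  with assms show ?thesis by (simp add: inverse_on_def)
qed

text \<open>Carries the entry formula of \<open>ordering_aux\<close>, stated for real matrices, over
  to complex Kronecker products.\<close>

lemma map_mat_kronecker_prod:
  "map_mat (of_real :: real \<Rightarrow> 'a::real_algebra_1) (kronecker_prod X D) =
    kronecker_prod (\<lambda>d. map_mat of_real (X d)) D"
proof (induction D)
  case 0
  show ?case by (rule eq_matI) auto
next
  case (Suc D)
  have *: "map_mat (of_real :: real \<Rightarrow> 'a) (kronecker A B) = kronecker (map_mat of_real A) (map_mat of_real B)"
    for A B :: "real mat"
  proof (rule eq_matI)
    fix i j
    assume "i < dim_row (kronecker (map_mat (of_real :: real \<Rightarrow> 'a) A) (map_mat of_real B))"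
      and "j < dim_col (kronecker (map_mat (of_real :: real \<Rightarrow> 'a) A) (map_mat of_real B))"
    then have ij: "i < dim_row A * dim_row B" "j < dim_col A * dim_col B"
      by (simp_all add: kronecker_def)
    then have "i div dim_row B < dim_row A" "j div dim_col B < dim_col A"
      "i mod dim_row B < dim_row B" "j mod dim_col B < dim_col B"
      by (auto simp: less_mult_imp_div_less intro!: mod_less_divisor gr0I)
    with ij show "map_mat (of_real :: real \<Rightarrow> 'a) (kronecker A B) $$ (i, j) =
        kronecker (map_mat of_real A) (map_mat of_real B) $$ (i, j)"
      by (simp add: kronecker_def)
  qed (simp_all add: kronecker_def)
  show ?case by (simp add: * Suc.IH)
qed

lemma prod_of_bool:
  "finite A \<Longrightarrow> (\<Prod>x\<in>A. of_bool (P x)) = (of_bool (\<forall>x\<in>A. P x) :: 'a::comm_semiring_1)"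
  by (induction A rule: finite_induct) auto

text \<open>The entries of the two eigenprojections of \<^const>\<open>complete_mat\<close>, in the order of
  \<^const>\<open>lattice_eigenvalue\<close>, and their coefficients with respect to \<open>K\<close> and \<open>I\<close>.\<close>

definition proj_entry :: "nat \<Rightarrow> nat \<Rightarrow> nat \<Rightarrow> nat \<Rightarrow> complex" where
  "proj_entry m j a b = (if j = 0 then 1 / of_nat m else of_bool (a = b) - 1 / of_nat m)"

definition proj_coeff :: "nat \<Rightarrow> nat \<Rightarrow> nat \<Rightarrow> complex" where
  "proj_coeff m j i =
    (if j = 0 then 1 / of_nat m else if i = 0 then - 1 / of_nat m else (of_nat m - 1) / of_nat m)"

text \<open>The projections are \<open>1 / m\<close> times the all-ones matrix and its complement in
  the identity. For \<open>m = 1\<close> the complement is zero, and the rule still holds.\<close>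

lemma proj_entry_mult:
  assumes "a < m" "b < m" "j \<in> {0, 1}" "j' \<in> {0, 1}"
  shows "(\<Sum>w<m. proj_entry m j a w * proj_entry m j' w b) = of_bool (j = j') * proj_entry m j a b"
proof -
  have m: "of_nat m \<noteq> (0 :: complex)" using assms by simp
  have 1: "(\<Sum>w<m. of_bool (a = w)) = (1 :: complex)" "(\<Sum>w<m. of_bool (w = b)) = (1 :: complex)"
    "(\<Sum>w<m. of_bool (a = w) * of_bool (w = b)) = (of_bool (a = b) :: complex)"
  proof -
    have "(\<Sum>w<m. of_bool (a = w) * of_bool (w = b)) = (\<Sum>w<m. if a = w then of_bool (a = b) else (0 :: complex))"
      by (rule sum.cong) auto
    then show "(\<Sum>w<m. of_bool (a = w) * of_bool (w = b)) = (of_bool (a = b) :: complex)"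
      using assms by simp
  qed (use assms in \<open>simp_all add: of_bool_def\<close>)
  have c: "{..<m} \<inter> {a} = {a}" "{..<m} \<inter> {b} = {b}" using assms by auto
  show ?thesis
    using assms(3,4) m
    by (auto simp: proj_entry_def left_diff_distrib right_diff_distrib sum_subtractf sum.distrib
        1 c sum_divide_distrib[symmetric])
qed

text \<open>The left side is an entry of \<open>K\<close> for \<open>i = 0\<close> and of
  \<open>I\<close> for \<open>i = 1\<close>; the right side is its spectral decomposition.\<close>

lemma link_factor_eq_proj:
  assumes "i \<in> {0, 1}" "0 < m"
  shows "of_bool ((i = 0) = (a \<noteq> b)) = (\<Sum>j\<in>{0, 1}. lattice_eigenvalue m i j * proj_entry m j a b)"
  using assms by (auto simp: lattice_eigenvalue_def proj_entry_def field_simps)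

lemma proj_eq_link_factor:
  assumes "j \<in> {0, 1}" "0 < m"
  shows "proj_entry m j a b = (\<Sum>i\<in>{0, 1}. proj_coeff m j i * of_bool ((i = 0) = (a \<noteq> b)))"
  using assms by (auto simp: proj_coeff_def proj_entry_def field_simps)

text \<open>An identity between scalars, so it also covers \<open>m = 1\<close> and
  \<open>j = 1\<close>, where the projection is zero and comparing matrices would give no
  equation.\<close>

lemma proj_coeff_dual:
  assumes "j \<in> {0, 1}" "j' \<in> {0, 1}" "0 < m"
  shows "(\<Sum>i\<in>{0, 1}. proj_coeff m j i * lattice_eigenvalue m i j') = of_bool (j = j')"
  using assms by (auto simp: proj_coeff_def lattice_eigenvalue_def field_simps)

section \<open>Spectral decomposition of the lattice\<close>

text \<open>The \<open>\<nu>\<close> of a \<^const>\<open>lattice_ordering\<close> need not be the mixed-radix numbering \<open>\<mu>\<close> underlying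
  \<^const>\<open>kronecker_prod\<close>; all computations are made with the latter.\<close>

locale kronecker_numbering =
  fixes D N :: nat and M :: "nat \<Rightarrow> nat" and \<mu> :: "nat \<Rightarrow> nat \<Rightarrow> nat"
  assumes M_pos: "\<And>d. d \<in> {1..D} \<Longrightarrow> 0 < M d"
    and bij: "bij_betw \<mu> {..<N} (lattice_nodes D M)"
begin

abbreviation J :: "(nat \<Rightarrow> nat) set" where "J \<equiv> {1..D} \<rightarrow>\<^sub>E {0, 1}"

text \<open>Entry of the Kronecker product with \<open>K\<close> in the dimensions where
  \<open>Q\<close> holds and \<open>I\<close> in the others. The type is generic because means and
  variances are real while the resolvent is complex.\<close>

definition link_entry :: "(nat \<Rightarrow> bool) \<Rightarrow> nat \<Rightarrow> nat \<Rightarrow> 'a::comm_semiring_1" where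
  "link_entry Q k l = (\<Prod>d=1..D. of_bool (Q d = (\<mu> k d \<noteq> \<mu> l d)))"

lemma of_real_link_entry: "of_real (link_entry Q k l) = link_entry Q k l"
  unfolding link_entry_def of_real_prod by (intro prod.cong) (auto simp: of_bool_def)

lemma \<mu>_less: "k < N \<Longrightarrow> d \<in> {1..D} \<Longrightarrow> \<mu> k d < M d"
  using bij_betw_apply[OF bij, of k] by (auto simp: lattice_nodes_def PiE_iff)

lemma \<mu>_eqI:
  assumes "k < N" "l < N" "\<And>d. d \<in> {1..D} \<Longrightarrow> \<mu> k d = \<mu> l d"
  shows "k = l"
proof -
  have "\<mu> k \<in> lattice_nodes D M" "\<mu> l \<in> lattice_nodes D M"
    using bij assms(1,2) by (auto simp: bij_betw_def)
  then have "\<mu> k = \<mu> l"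
    unfolding lattice_nodes_def using assms(3) by (rule PiE_ext)
  then show ?thesis using bij assms(1,2) by (auto simp: bij_betw_def inj_on_def)
qed

text \<open>The numbering meets every tuple once, so such sums factor over the coordinates. This
  takes the place of the mixed-product rule for Kronecker products.\<close>

lemma sum_prod_numbering:
  fixes h :: "nat \<Rightarrow> nat \<Rightarrow> 'a::comm_semiring_1"
  shows "(\<Sum>l<N. \<Prod>d=1..D. h d (\<mu> l d)) = (\<Prod>d=1..D. \<Sum>w<M d. h d w)"
proof -
  have "(\<Sum>l<N. \<Prod>d=1..D. h d (\<mu> l d)) = (\<Sum>x\<in>lattice_nodes D M. \<Prod>d=1..D. h d (x d))"
    by (rule sum.reindex_bij_betw[OF bij])
  then show ?thesis by (simp add: lattice_nodes_def prod_sum_PiE)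
qed

lemma link_entry_refl: "link_entry Q k k = of_bool (\<forall>d\<in>{1..D}. \<not> Q d)"
  by (simp add: link_entry_def prod_of_bool)

lemma link_entry_sym: "link_entry Q k l = link_entry Q l k"
  by (auto simp: link_entry_def intro!: prod.cong)

lemma link_entry_False:
  assumes "k < N" "l < N"
  shows "link_entry (\<lambda>_. False) k l = of_bool (k = l)"
proof -
  have "(\<forall>d\<in>{1..D}. \<mu> k d = \<mu> l d) \<longleftrightarrow> k = l" using \<mu>_eqI[OF assms] by blast
  then show ?thesis by (simp add: link_entry_def prod_of_bool)
qed

text \<open>Counts the neighbours of a node along \<open>d\<close>: coordinate \<open>d\<close>
  admits \<open>M d - 1\<close> other symbols and every other coordinate is fixed.\<close>

lemma row_sum_link_entry:
  assumes k: "k < N" and d: "d \<in> {1..D}"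
  shows "(\<Sum>l<N. link_entry (\<lambda>e. e = d) k l :: real) = real (M d) - 1"
proof -
  have "(\<Sum>l<N. link_entry (\<lambda>e. e = d) k l :: real) =
      (\<Prod>e=1..D. \<Sum>w<M e. of_bool ((e = d) = (\<mu> k e \<noteq> w)))"
    unfolding link_entry_def
    by (rule sum_prod_numbering[where h = "\<lambda>e w. of_bool ((e = d) = (\<mu> k e \<noteq> w))"])
  also have "\<dots> = (\<Prod>e=1..D. if e = d then real (M d) - 1 else 1)"
  proof (rule prod.cong[OF refl])
    fix e assume e: "e \<in> {1..D}"
    have 1: "(\<Sum>w<M e. of_bool (\<mu> k e = w)) = (1 :: real)"
      using \<mu>_less[OF k e] by (simp add: of_bool_def)
    have "(\<Sum>w<M e. of_bool (\<mu> k e \<noteq> w)) = (\<Sum>w<M e. 1 - of_bool (\<mu> k e = w) :: real)"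
      by (rule sum.cong) auto
    also have "\<dots> = real (M e) - 1"
      by (simp only: sum_subtractf 1) simp
    finally show "(\<Sum>w<M e. of_bool ((e = d) = (\<mu> k e \<noteq> w))) = (if e = d then real (M d) - 1 else 1)"
      using 1 by (cases "e = d") (simp_all only: simp_thms if_True if_False)
  qed
  also have "\<dots> = real (M d) - 1" using d by (simp add: prod.delta)
  finally show ?thesis .
qed

text \<open>Transitivity on the nodes: swapping two symbols in each coordinate moves node
  \<open>k\<close> to node \<open>l\<close>, and, being injective in each coordinate, preserves
  whether two nodes differ there.\<close>

lemma link_entry_transposition:
  assumes k: "k < N" and l: "l < N"
  obtains \<tau> where "bij_betw \<tau> {..<N} {..<N}" "\<tau> k = l"
    "\<And>Q i j. i < N \<Longrightarrow> j < N \<Longrightarrow> (link_entry Q (\<tau> i) (\<tau> j) :: 'a::comm_semiring_1) = link_entry Q i j"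
proof -
  define T where "T x = (\<lambda>d\<in>{1..D}. Transposition.transpose (\<mu> k d) (\<mu> l d) (x d))" for x :: "nat \<Rightarrow> nat"
  have T: "T x \<in> lattice_nodes D M" if "x \<in> lattice_nodes D M" for x
    using that \<mu>_less[OF k] \<mu>_less[OF l]
    by (auto simp: T_def lattice_nodes_def PiE_iff Transposition.transpose_def)
  \<comment> \<open>\<open>T\<close> acts on tuples; conjugation with the numbering makes it act on
    indices.\<close>
  define \<tau> where "\<tau> i = inv_into {..<N} \<mu> (T (\<mu> i))" for i
  have \<mu>\<tau>: "\<mu> (\<tau> i) = T (\<mu> i)" and \<tau>N: "\<tau> i < N" if "i < N" for i
  proof -
    have "T (\<mu> i) \<in> \<mu> ` {..<N}" using T bij that by (auto simp: bij_betw_def)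
    then show "\<mu> (\<tau> i) = T (\<mu> i)" "\<tau> i < N"
      unfolding \<tau>_def using inv_into_into[of "T (\<mu> i)" \<mu> "{..<N}"] by (auto intro: f_inv_into_f)
  qed
  have "inj_on \<tau> {..<N}"
  proof (rule inj_onI)
    fix i j assume "i \<in> {..<N}" "j \<in> {..<N}" "\<tau> i = \<tau> j"
    then have ij: "i < N" "j < N" and "\<mu> (\<tau> i) = \<mu> (\<tau> j)" by simp_all
    then have eq: "T (\<mu> i) = T (\<mu> j)" by (simp only: \<mu>\<tau>)
    have "\<mu> i d = \<mu> j d" if "d \<in> {1..D}" for d
      using that fun_cong[OF eq, of d] by (simp add: T_def inj_eq[OF inj_on_transpose])
    with ij show "i = j" by (rule \<mu>_eqI)
  qed
  then have "bij_betw \<tau> {..<N} {..<N}"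
    using \<tau>N endo_inj_surj[of "{..<N}" \<tau>] by (auto simp: bij_betw_def)
  moreover have "\<tau> k = l"
    by (rule \<mu>_eqI) (use k l \<tau>N \<mu>\<tau> in \<open>auto simp: T_def\<close>)
  moreover have "(link_entry Q (\<tau> i) (\<tau> j) :: 'a) = link_entry Q i j" if "i < N" "j < N" for Q i j
    unfolding link_entry_def \<mu>\<tau>[OF that(1)] \<mu>\<tau>[OF that(2)]
    by (rule prod.cong[OF refl]) (simp add: T_def inj_eq[OF inj_on_transpose])
  ultimately show ?thesis using that by blast
qed

section \<open>Eigenprojections of the lattice and their functional calculus\<close>

definition spectral_entry :: "(nat \<Rightarrow> nat) \<Rightarrow> nat \<Rightarrow> nat \<Rightarrow> complex" where
  "spectral_entry j k l = (\<Prod>d=1..D. proj_entry (M d) (j d) (\<mu> k d) (\<mu> l d))"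

lemma prod_of_bool_eq_J:
  assumes "j \<in> J" "j' \<in> J"
  shows "(\<Prod>d=1..D. of_bool (j d = j' d)) = (of_bool (j = j') :: 'a::comm_semiring_1)"
proof -
  have "(\<forall>d\<in>{1..D}. j d = j' d) \<longleftrightarrow> j = j'" using assms by (metis PiE_ext)
  then show ?thesis by (simp add: prod_of_bool)
qed

text \<open>The sum factors over coordinates, and two different indices differ in some coordinate,
  where the factor vanishes.\<close>

lemma spectral_entry_mult:
  assumes "k < N" "n < N" "j \<in> J" "j' \<in> J"
  shows "(\<Sum>l<N. spectral_entry j k l * spectral_entry j' l n) = of_bool (j = j') * spectral_entry j k n"
proof -
  have "(\<Sum>l<N. spectral_entry j k l * spectral_entry j' l n) =
      (\<Prod>d=1..D. \<Sum>w<M d. proj_entry (M d) (j d) (\<mu> k d) w * proj_entry (M d) (j' d) w (\<mu> n d))"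
    unfolding spectral_entry_def prod.distrib[symmetric] by (rule sum_prod_numbering)
  also have "\<dots> = (\<Prod>d=1..D. of_bool (j d = j' d) * proj_entry (M d) (j d) (\<mu> k d) (\<mu> n d))"
    using assms by (intro prod.cong refl proj_entry_mult \<mu>_less) auto
  finally show ?thesis
    by (simp only: prod.distrib prod_of_bool_eq_J[OF assms(3,4)] spectral_entry_def)
qed

lemma link_entry_spectral:
  assumes "i \<in> J"
  shows "link_entry (\<lambda>d. i d = 0) k l =
    (\<Sum>j\<in>J. (\<Prod>d=1..D. lattice_eigenvalue (M d) (i d) (j d)) * spectral_entry j k l)"
proof -
  have "link_entry (\<lambda>d. i d = 0) k l = (\<Prod>d=1..D. \<Sum>j\<in>{0, 1}.
      lattice_eigenvalue (M d) (i d) j * proj_entry (M d) j (\<mu> k d) (\<mu> l d))"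
    unfolding link_entry_def
    using assms M_pos by (intro prod.cong refl link_factor_eq_proj) auto
  then show ?thesis
    by (simp only: prod_sum_PiE finite.intros finite_atLeastAtMost prod.distrib spectral_entry_def)
qed

lemma spectral_entry_link:
  assumes "j \<in> J"
  shows "spectral_entry j k l =
    (\<Sum>i\<in>J. (\<Prod>d=1..D. proj_coeff (M d) (j d) (i d)) * link_entry (\<lambda>d. i d = 0) k l)"
proof -
  have "spectral_entry j k l = (\<Prod>d=1..D. \<Sum>i\<in>{0, 1}.
      proj_coeff (M d) (j d) i * of_bool ((i = 0) = (\<mu> k d \<noteq> \<mu> l d)))"
    unfolding spectral_entry_def
    using assms M_pos by (intro prod.cong refl proj_eq_link_factor) auto
  then show ?thesis
    by (simp only: prod_sum_PiE finite.intros finite_atLeastAtMost prod.distrib link_entry_def)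
qed

text \<open>Duality of coefficients and eigenvalues, multiplied out over the dimensions; it is what
  yields the rational equations.\<close>

lemma sum_proj_coeff_eigenvalue:
  assumes "j \<in> J" "j' \<in> J"
  shows "(\<Sum>i\<in>J. (\<Prod>d=1..D. proj_coeff (M d) (j d) (i d)) *
    (\<Prod>d=1..D. lattice_eigenvalue (M d) (i d) (j' d))) = of_bool (j = j')"
proof -
  have "(\<Sum>i\<in>J. (\<Prod>d=1..D. proj_coeff (M d) (j d) (i d)) *
      (\<Prod>d=1..D. lattice_eigenvalue (M d) (i d) (j' d))) =
    (\<Prod>d=1..D. \<Sum>i\<in>{0, 1}. proj_coeff (M d) (j d) i * lattice_eigenvalue (M d) i (j' d))"
    by (simp only: prod_sum_PiE finite.intros finite_atLeastAtMost prod.distrib)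
  also have "\<dots> = (\<Prod>d=1..D. of_bool (j d = j' d))"
    using assms M_pos by (intro prod.cong refl proj_coeff_dual) auto
  also have "\<dots> = of_bool (j = j')" by (rule prod_of_bool_eq_J[OF assms])
  finally show ?thesis .
qed

text \<open>By orthogonality, combinations of the projections multiply coefficientwise; a
  combination with nonzero coefficients is thus inverted by taking reciprocals.\<close>

lemma spectral_function_mult:
  assumes "k < N" "n < N"
  shows "(\<Sum>l<N. (\<Sum>j\<in>J. f j * spectral_entry j k l) * (\<Sum>j\<in>J. g j * spectral_entry j l n)) =
    (\<Sum>j\<in>J. f j * g j * spectral_entry j k n)"
proof -
  have fin: "finite J" by (intro finite_PiE) auto
  have "(\<Sum>l<N. (\<Sum>j\<in>J. f j * spectral_entry j k l) * (\<Sum>j\<in>J. g j * spectral_entry j l n)) =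
      (\<Sum>l<N. \<Sum>j\<in>J. \<Sum>j'\<in>J. f j * g j' * (spectral_entry j k l * spectral_entry j' l n))"
    by (simp add: sum_product mult.assoc mult.left_commute)
  also have "\<dots> = (\<Sum>j\<in>J. \<Sum>j'\<in>J. \<Sum>l<N. f j * g j' * (spectral_entry j k l * spectral_entry j' l n))"
    by (subst sum.swap, intro sum.cong refl, rule sum.swap)
  also have "\<dots> = (\<Sum>j\<in>J. \<Sum>j'\<in>J. if j = j' then f j * g j * spectral_entry j k n else 0)"
    using assms by (intro sum.cong refl) (simp add: sum_distrib_left[symmetric] spectral_entry_mult)
  also have "\<dots> = (\<Sum>j\<in>J. f j * g j * spectral_entry j k n)"
    using fin by simp
  finally show ?thesis .
qed

lemma spectral_function_const:
  assumes "k < N" "l < N"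
  shows "(\<Sum>j\<in>J. a * spectral_entry j k l) = a * of_bool (k = l)"
proof -
  \<comment> \<open>The index that is one everywhere selects the product of identities, with all
    eigenvalues one; its decomposition is the resolution of the identity.\<close>
  have "(\<lambda>d\<in>{1..D}. 1) \<in> J" by auto
  from link_entry_spectral[OF this, of k l]
  have "(\<Sum>j\<in>J. spectral_entry j k l) = link_entry (\<lambda>d. (\<lambda>d\<in>{1..D}. 1::nat) d = 0) k l"
    by (simp add: lattice_eigenvalue_def)
  also have "\<dots> = link_entry (\<lambda>_. False) k l"
    unfolding link_entry_def by (intro prod.cong refl) auto
  finally show ?thesis
    using assms by (simp add: link_entry_False sum_distrib_left[symmetric])
qed

lemma link_entry_along_spectral:
  assumes d: "d \<in> {1..D}"
  shows "link_entry (\<lambda>e. e = d) k l = (\<Sum>j\<in>J. lattice_eigenvalue (M d) 0 (j d) * spectral_entry j k l)"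
proof -
  \<comment> \<open>This index selects \<open>K\<close> in dimension \<open>d\<close> only; the
    other factors are identities with eigenvalue one.\<close>
  let ?i = "\<lambda>e\<in>{1..D}. if e = d then 0 else 1 :: nat"
  have "?i \<in> J" by auto
  from link_entry_spectral[OF this, of k l]
  have "link_entry (\<lambda>e. ?i e = 0) k l =
      (\<Sum>j\<in>J. (\<Prod>e=1..D. lattice_eigenvalue (M e) (?i e) (j e)) * spectral_entry j k l)" .
  moreover have "link_entry (\<lambda>e. ?i e = 0) k l = (link_entry (\<lambda>e. e = d) k l :: complex)"
    unfolding link_entry_def by (intro prod.cong refl) auto
  moreover have "(\<Prod>e=1..D. lattice_eigenvalue (M e) (?i e) (j e)) = lattice_eigenvalue (M d) 0 (j d)" for j
  proof -
    have "(\<Prod>e=1..D. lattice_eigenvalue (M e) (?i e) (j e)) =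
        (\<Prod>e=1..D. if e = d then lattice_eigenvalue (M d) 0 (j d) else 1)"
      by (intro prod.cong refl) (auto simp: lattice_eigenvalue_def)
    then show ?thesis using d by (simp add: prod.delta)
  qed
  ultimately show ?thesis by simp
qed

end

lemma kronecker_numbering_exists:
  assumes "\<forall>d\<in>{1..D}. 0 < M d" and N: "N = (\<Prod>d=1..D. M d)"
  obtains \<mu> where "kronecker_numbering D N M \<mu>"
    "\<And>Q k l. k < N \<Longrightarrow> l < N \<Longrightarrow>
      kronecker_prod (\<lambda>d. if Q d then complete_mat (M d) else 1\<^sub>m (M d)) D $$ (k, l) =
      (kronecker_numbering.link_entry D \<mu> Q k l :: real)"
    "\<And>Q k l. k < N \<Longrightarrow> l < N \<Longrightarrow>
      kronecker_prod (\<lambda>d. if Q d then complete_mat (M d) else 1\<^sub>m (M d)) D $$ (k, l) =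
      (kronecker_numbering.link_entry D \<mu> Q k l :: complex)"
proof -
  obtain \<mu> where \<mu>: "bij_betw \<mu> {..<N} (lattice_nodes D M)"
    and ent: "\<And>X::nat \<Rightarrow> real mat. \<And>k l. (\<forall>d\<in>{1..D}. X d \<in> carrier_mat (M d) (M d)) \<Longrightarrow>
        k < N \<Longrightarrow> l < N \<Longrightarrow> kronecker_prod X D $$ (k, l) = (\<Prod>d=1..D. X d $$ (\<mu> k d, \<mu> l d))"
    using ordering_aux[OF assms(1)] unfolding N by auto
  interpret kronecker_numbering D N M \<mu>
    using assms(1) \<mu> by unfold_locales auto
  let ?K = "\<lambda>Q d. if Q d then complete_mat (M d) else 1\<^sub>m (M d)"
  have K: "?K Q d \<in> carrier_mat (M d) (M d)" for Q d by (simp add: complete_mat_def)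
  have real: "kronecker_prod (?K Q) D $$ (k, l) = (link_entry Q k l :: real)" if "k < N" "l < N" for Q k l
    unfolding link_entry_def
    by (subst ent) (use that K in \<open>auto simp: complete_mat_def \<mu>_less intro!: prod.cong\<close>)
  moreover have "kronecker_prod (?K Q) D $$ (k, l) = (link_entry Q k l :: complex)"
    if kl: "k < N" "l < N" for Q k l
  proof -
    have "(\<lambda>d. map_mat complex_of_real (?K Q d)) = ?K Q"
    proof
      fix d show "map_mat complex_of_real (?K Q d) = ?K Q d"
        by (cases "Q d"; intro eq_matI) (auto simp: complete_mat_def)
    qed
    then have "kronecker_prod (?K Q) D = map_mat complex_of_real (kronecker_prod (?K Q) D)"
      by (simp add: map_mat_kronecker_prod)
    moreover have "(kronecker_prod (?K Q) D :: real mat) \<in> carrier_mat N N"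
      unfolding N by (rule dim_kronecker_prod) (rule K)
    ultimately have "kronecker_prod (?K Q) D $$ (k, l) =
        complex_of_real (kronecker_prod (?K Q) D $$ (k, l))"
      using kl by simp
    then show ?thesis using real[OF kl] by (simp add: of_real_link_entry)
  qed
  ultimately show ?thesis using that kronecker_numbering_axioms by blast
qed


section \<open>Girko's matrix for the lattice percolation\<close>

text \<open>The kernel lemma makes the matrix invertible off the real axis, so \<open>the\<close> in
  \<open>girko_mat\<close> yields a genuine inverse. This is the passage from matrices to entry
  functions.\<close>

lemma girko_mat_inverse_on:
  fixes P :: "'w measure" and N :: nat and W :: "'w \<Rightarrow> real mat" and c :: "nat \<Rightarrow> complex \<Rightarrow> complex"
  defines "B \<equiv> expectation_mat P N W"
  assumes sym: "\<And>k l. k < N \<Longrightarrow> l < N \<Longrightarrow> B $$ (k, l) = B $$ (l, k)"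
    and c: "\<And>k. k < N \<Longrightarrow> 0 < Im z * Im (c k z)" and z: "Im z \<noteq> 0"
  shows "girko_mat P N W c z \<in> carrier_mat N N"
    and "inverse_on {..<N}
      (K1_operator {..<N} (\<lambda>k l. complex_of_real (B $$ (k, l)))
        (\<lambda>j t. \<integral>\<omega>. (W \<omega> $$ (j, t) - B $$ (j, t))\<^sup>2 \<partial>P) z (\<lambda>k. c k z))
      (\<lambda>k l. girko_mat P N W c z $$ (k, l))"
proof -
  let ?s = "\<lambda>j t. \<integral>\<omega>. (W \<omega> $$ (j, t) - B $$ (j, t))\<^sup>2 \<partial>P"
  let ?K = "K1_operator {..<N} (\<lambda>k l. complex_of_real (B $$ (k, l))) ?s z (\<lambda>k. c k z)"
  define A where "A = map_mat complex_of_real B - z \<cdot>\<^sub>m 1\<^sub>m N -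
    Matrix.mat N N (\<lambda>(l, j). if l = j
      then \<Sum>s<N. c s z * complex_of_real (\<integral>\<omega>. ((W \<omega> - B) $$ (j, s))\<^sup>2 \<partial>P) else 0)"
  have g: "girko_mat P N W c z = the (mat_inverse A)"
    unfolding girko_mat_def Let_def A_def B_def by (rule refl)
  have B: "B \<in> carrier_mat N N" by (simp add: B_def expectation_mat_def)
  have A: "A \<in> carrier_mat N N" unfolding A_def by (intro minus_carrier_mat mat_carrier)
  have entry: "A $$ (k, l) = ?K k l" if "k < N" "l < N" for k l
    using that B by (simp add: A_def K1_operator_def mult.commute)
  have "v = 0\<^sub>v N" if v: "v \<in> carrier_vec N" and Av: "A *\<^sub>v v = 0\<^sub>v N" for v
  proof (rule eq_vecI)
    fix k assume "k < dim_vec (0\<^sub>v N :: complex vec)"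
    then have k: "k \<in> {..<N}" by simp
    have "v $ k = 0"
    proof (rule K1_operator_kernel[where b = "\<lambda>k l. complex_of_real (B $$ (k, l))" and s = ?s
          and z = z and c = "\<lambda>k. c k z" and I = "{..<N}", OF _ _ _ _ z _ k])
      fix i assume i: "i \<in> {..<N}"
      have "(\<Sum>j<N. ?K i j * v $ j) = (A *\<^sub>v v) $ i"
        using i A v by (simp add: scalar_prod_def lessThan_atLeast0 entry)
      then show "(\<Sum>j<N. ?K i j * v $ j) = 0" using i by (simp add: Av)
    qed (use sym c in auto)
    then show "v $ k = 0\<^sub>v N $ k" using k by simp
  qed (use v in simp)
  then have inv: "the (mat_inverse A) \<in> carrier_mat N N" "A * the (mat_inverse A) = 1\<^sub>m N"
      "the (mat_inverse A) * A = 1\<^sub>m N"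
    using the_mat_inverse[OF A] by blast+
  show "girko_mat P N W c z \<in> carrier_mat N N" unfolding g by (rule inv(1))
  show "inverse_on {..<N} ?K (\<lambda>k l. girko_mat P N W c z $$ (k, l))"
    unfolding g by (rule inverse_on_cong[OF inverse_on_index_mat[OF A inv]]) (rule entry[symmetric]; simp)
qed

section \<open>Means and variances of the percolation matrix\<close>

lemma (in prob_space) two_valued_moments:
  assumes A: "A \<in> events" and f: "\<And>\<omega>. \<omega> \<in> space M \<Longrightarrow> f \<omega> = a * of_bool (\<omega> \<in> A)"
  shows "(\<integral>\<omega>. f \<omega> \<partial>M) = a * prob A"
    and "(\<integral>\<omega>. (f \<omega> - a * prob A)\<^sup>2 \<partial>M) = a\<^sup>2 * (prob A * (1 - prob A))"
proof -
  have i: "integrable M (indicator A :: 'a \<Rightarrow> real)"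
    by (intro integrable_real_indicator A) (simp add: less_top[symmetric])
  have "(\<integral>\<omega>. f \<omega> \<partial>M) = (\<integral>\<omega>. a * indicator A \<omega> \<partial>M)"
    by (rule Bochner_Integration.integral_cong) (auto simp: f)
  then show "(\<integral>\<omega>. f \<omega> \<partial>M) = a * prob A" using A by simp
  \<comment> \<open>An indicator equals its square, so the squared deviation is affine in
    it.\<close>
  have "(\<integral>\<omega>. (f \<omega> - a * prob A)\<^sup>2 \<partial>M) =
      (\<integral>\<omega>. a\<^sup>2 * (1 - 2 * prob A) * indicator A \<omega> + a\<^sup>2 * (prob A)\<^sup>2 \<partial>M)"
    by (rule Bochner_Integration.integral_cong)
       (auto simp: f indicator_def power2_eq_square algebra_simps)
  also have "\<dots> = a\<^sup>2 * (1 - 2 * prob A) * prob A + a\<^sup>2 * (prob A)\<^sup>2"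
    using A i by (subst Bochner_Integration.integral_add) (auto simp: prob_space)
  also have "\<dots> = a\<^sup>2 * (prob A * (1 - prob A))"
    by (simp add: power2_eq_square algebra_simps)
  finally show "(\<integral>\<omega>. (f \<omega> - a * prob A)\<^sup>2 \<partial>M) = a\<^sup>2 * (prob A * (1 - prob A))" .
qed

lemma lattice_links_along_unique:
  assumes "{x, y} \<in> lattice_links_along D M d" "{x, y} \<in> lattice_links_along D M e"
  shows "d = e"
  using assms unfolding lattice_links_along_iff by auto

text \<open>An entry of \<open>W\<close> is \<open>1 / \<gamma>\<close> times the indicator of one
  link event, and a link lies along at most one dimension, so each sum over dimensions has at most
  one nonzero term.\<close>

lemma percolation_moments:
  fixes W :: "'w \<Rightarrow> real mat"
  assumes \<nu>: "lattice_ordering D M \<nu>" and G: "lattice_percolation P D M p G"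
    and N: "N = (\<Prod>d=1..D. M d)" and W: "W = (\<lambda>\<omega>. (1 / \<gamma>) \<cdot>\<^sub>m adjacency_mat N \<nu> (G \<omega>))"
    and k: "k < N" and l: "l < N"
  defines "K \<equiv> \<lambda>j. kronecker_prod (\<lambda>d. if d = j then complete_mat (M d) else 1\<^sub>m (M d)) D $$ (k, l)"
  shows "expectation_mat P N W $$ (k, l) = 1 / \<gamma> * (\<Sum>d=1..D. p d * K d)"
    and "(\<integral>\<omega>. (W \<omega> $$ (k, l) - expectation_mat P N W $$ (k, l))\<^sup>2 \<partial>P) =
      1 / \<gamma>\<^sup>2 * (\<Sum>d=1..D. p d * (1 - p d) * K d)"
proof -
  let ?e = "{\<nu> k, \<nu> l}"
  interpret prob_space P using G by (simp add: lattice_percolation_def)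
  define A where "A = {\<omega> \<in> space P. ?e \<in> G \<omega>}"
  \<comment> \<open>Here the ordering of the nodes enters: it makes Kronecker entries indicators of
    links along \<open>d\<close>.\<close>
  have K: "K d = of_bool (?e \<in> lattice_links_along D M d)" if "d \<in> {1..D}" for d
  proof -
    have "adjacency_mat N \<nu> (lattice_links_along D M d) =
        (kronecker_prod (\<lambda>e. if e = d then complete_mat (M e) else 1\<^sub>m (M e)) D :: real mat)"
      using \<nu> that by (simp add: lattice_ordering_def N)
    from arg_cong[OF this[symmetric], of "\<lambda>X. X $$ (k, l)"] show ?thesis
      using k l by (simp add: K_def adjacency_mat_def)
  qed
  have A: "A \<in> events \<and> prob A = (\<Sum>d=1..D. p d * K d) \<and>
      prob A * (1 - prob A) = (\<Sum>d=1..D. p d * (1 - p d) * K d)"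
  proof (cases "?e \<in> lattice_links D M")
    case True
    then obtain d where d: "d \<in> {1..D}" "?e \<in> lattice_links_along D M d"
      by (auto simp: lattice_links_def)
    have K': "K e = of_bool (e = d)" if "e \<in> {1..D}" for e
      using K[OF that] d lattice_links_along_unique by auto
    have "(\<Sum>e=1..D. f e * K e) = f d" for f :: "nat \<Rightarrow> real"
    proof -
      have "(\<Sum>e=1..D. f e * K e) = (\<Sum>e=1..D. if e = d then f d else 0)"
        by (rule sum.cong) (auto simp: K')
      then show ?thesis using d by simp
    qed
    moreover have "A \<in> events"
      using G True by (auto simp: lattice_percolation_def indep_events_def A_def)
    moreover have "prob A = p d"
      using G d by (simp add: lattice_percolation_def A_def)
    ultimately show ?thesis by simp
  next
    case False
    \<comment> \<open>Not a lattice link, as for instance on the diagonal: the event is empty and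
      all Kronecker entries vanish.\<close>
    then have "A = {}" using G by (auto simp: lattice_percolation_def A_def)
    moreover have "K d = 0" if "d \<in> {1..D}" for d
      using K[OF that] that False by (auto simp: lattice_links_def)
    ultimately show ?thesis by simp
  qed
  have f: "W \<omega> $$ (k, l) = 1 / \<gamma> * of_bool (\<omega> \<in> A)" if "\<omega> \<in> space P" for \<omega>
    using that k l by (simp add: W A_def adjacency_mat_def)
  note m = two_valued_moments[OF conjunct1[OF A], of "\<lambda>\<omega>. W \<omega> $$ (k, l)", OF f]
  have E: "expectation_mat P N W $$ (k, l) = 1 / \<gamma> * prob A"
    using k l m(1) by (simp add: expectation_mat_def)
  with A show "expectation_mat P N W $$ (k, l) = 1 / \<gamma> * (\<Sum>d=1..D. p d * K d)" by simp
  have "(\<integral>\<omega>. (W \<omega> $$ (k, l) - expectation_mat P N W $$ (k, l))\<^sup>2 \<partial>P) =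
      (1 / \<gamma>)\<^sup>2 * (prob A * (1 - prob A))"
    unfolding E by (rule m(2))
  also have "prob A * (1 - prob A) = (\<Sum>d=1..D. p d * (1 - p d) * K d)" using A by blast
  finally show "(\<integral>\<omega>. (W \<omega> $$ (k, l) - expectation_mat P N W $$ (k, l))\<^sup>2 \<partial>P) =
      1 / \<gamma>\<^sup>2 * (\<Sum>d=1..D. p d * (1 - p d) * K d)"
    by (simp add: power_divide)
qed

theorem corollary1:
  fixes D N :: nat and M :: "nat \<Rightarrow> nat" and p :: "nat \<Rightarrow> real" and \<gamma> :: real
    and \<nu> :: "nat \<Rightarrow> nat \<Rightarrow> nat"
    and P :: "'w measure" and G :: "'w \<Rightarrow> (nat \<Rightarrow> nat) set set" and W :: "'w \<Rightarrow> real mat"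
    and c :: "nat \<Rightarrow> complex \<Rightarrow> complex" and F :: "real \<Rightarrow> real"
  assumes "1 \<le> D"
    and "\<forall>d\<in>{1..D}. 0 < M d"
    and "N = (\<Prod>d=1..D. M d)"
    and "\<forall>d\<in>{1..D}. 0 \<le> p d \<and> p d \<le> 1"
    and "\<gamma> = (\<Sum>d=1..D. p d * (real (M d) - 1))"
    and "0 < \<gamma>"
    and "lattice_ordering D M \<nu>"
    and "lattice_percolation P D M p G"
    and "W = (\<lambda>\<omega>. (1 / \<gamma>) \<cdot>\<^sub>m adjacency_mat N \<nu> (G \<omega>))"
    and "K1_equivalent P N W c F"
  shows "\<forall>z. Im z \<noteq> 0 \<longrightarrow>
    (\<exists>\<alpha> :: (nat \<Rightarrow> nat) \<Rightarrow> complex.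
      girko_mat P N W c z =
        finsum (module_mat TYPE(complex) N N)
          (\<lambda>i. \<alpha> i \<cdot>\<^sub>m kronecker_prod
                 (\<lambda>d. if i d = 0 then complete_mat (M d) else 1\<^sub>m (M d)) D)
          ({1..D} \<rightarrow>\<^sub>E {0, 1}) \<and>
      stieltjes_transform F z = \<alpha> (\<lambda>d\<in>{1..D}. 1) \<and>
      (\<forall>j \<in> {1..D} \<rightarrow>\<^sub>E {0, 1}.
        (\<Sum>i \<in> {1..D} \<rightarrow>\<^sub>E {0, 1}. \<alpha> i * (\<Prod>d=1..D. lattice_eigenvalue (M d) (i d) (j d))) =
        inverse
          (complex_of_real (1 / \<gamma>) *
             (\<Sum>d=1..D. complex_of_real (p d) * lattice_eigenvalue (M d) 0 (j d))
           - z
           - complex_of_real (1 / \<gamma>\<^sup>2 * (\<Sum>d=1..D. p d * (1 - p d) * (real (M d) - 1))) *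
             \<alpha> (\<lambda>d\<in>{1..D}. 1))))"
proof (intro allI impI)
  fix z assume z: "Im z \<noteq> 0"
  obtain \<mu> where num: "kronecker_numbering D N M \<mu>"
    and real_entry: "\<And>Q k l. k < N \<Longrightarrow> l < N \<Longrightarrow>
      kronecker_prod (\<lambda>d. if Q d then complete_mat (M d) else 1\<^sub>m (M d)) D $$ (k, l) =
      (kronecker_numbering.link_entry D \<mu> Q k l :: real)"
    and complex_entry: "\<And>Q k l. k < N \<Longrightarrow> l < N \<Longrightarrow>
      kronecker_prod (\<lambda>d. if Q d then complete_mat (M d) else 1\<^sub>m (M d)) D $$ (k, l) =
      (kronecker_numbering.link_entry D \<mu> Q k l :: complex)"
    using kronecker_numbering_exists[OF assms(2,3)] by blast
  interpret kronecker_numbering D N M \<mu> by (rule num)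
  let ?I = "{..<N}"
  have N: "0 < N" using assms(2,3) by (simp add: prod_pos)
  define B where "B = (\<lambda>k l. expectation_mat P N W $$ (k, l))"
  define s where "s = (\<lambda>j t. \<integral>\<omega>. (W \<omega> $$ (j, t) - expectation_mat P N W $$ (j, t))\<^sup>2 \<partial>P)"
  define C where "C = (\<lambda>k l. girko_mat P N W c z $$ (k, l))"
  let ?b = "\<lambda>k l. complex_of_real (B k l)"
  \<comment> \<open>The means are combinations of Kronecker entries, which are evaluated in the
    numbering \<open>\<mu>\<close>, whatever \<open>\<nu>\<close> is.\<close>
  have B: "B k l = 1 / \<gamma> * (\<Sum>d=1..D. p d * link_entry (\<lambda>e. e = d) k l)" if "k < N" "l < N" for k l
    using percolation_moments(1)[OF assms(7,8,3,9) that] real_entry[OF that] by (simp add: B_def)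
  have s: "s k l = 1 / \<gamma>\<^sup>2 * (\<Sum>d=1..D. p d * (1 - p d) * link_entry (\<lambda>e. e = d) k l)"
    if "k < N" "l < N" for k l
    using percolation_moments(2)[OF assms(7,8,3,9) that] real_entry[OF that] by (simp add: s_def)
  have B_sym: "B k l = B l k" if "k < N" "l < N" for k l
    using that by (simp add: B link_entry_sym[of _ k l])
  have s_nonneg: "0 \<le> s k l" for k l by (simp add: s_def)
  have K1: "girko_K1_solution P N W c"
    and S: "stieltjes_transform F z = 1 / of_nat N * (\<Sum>k<N. c k z)"
    using assms(10) z by (auto simp: K1_equivalent_def)
  have c_pos: "0 < Im z * Im (c k z)" and C_diag: "C k k = c k z" if "k < N" for k
    using K1 z that by (auto simp: girko_K1_solution_def half_plane_class_def C_def)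
  have C_carrier: "girko_mat P N W c z \<in> carrier_mat N N"
    and C: "inverse_on ?I (K1_operator ?I ?b s z (\<lambda>k. c k z)) C"
    using girko_mat_inverse_on[of N P W z c] B_sym c_pos z by (simp_all add: B_def s_def C_def)

  \<comment> \<open>The common value of the diagonal\<close>
  define m where "m = c 0 z"
  have c_const: "c k z = m" if k: "k < N" for k
  proof -
    \<comment> \<open>Means and variances depend on the indices only through
      \<open>link_entry\<close>, so this automorphism preserves both.\<close>
    obtain \<tau> where \<tau>: "bij_betw \<tau> ?I ?I" "\<tau> 0 = k"
      "\<And>Q i j. i < N \<Longrightarrow> j < N \<Longrightarrow> (link_entry Q (\<tau> i) (\<tau> j) :: real) = link_entry Q i j"
      using link_entry_transposition[OF N k] by metis
    have \<tau>N: "\<tau> i < N" if "i < N" for i using bij_betw_apply[OF \<tau>(1)] that by simp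
    have inv: "B (\<tau> i) (\<tau> j) = B i j" "s (\<tau> i) (\<tau> j) = s i j" if "i < N" "j < N" for i j
      using that by (simp_all add: B s \<tau>(3) \<tau>N)
    have "c (\<tau> 0) z = c 0 z"
      by (rule K1_solution_automorphism[OF _ \<tau>(1) _ _ _ _ C])
         (use N c_pos C_diag s_nonneg inv in \<open>auto simp: B_sym\<close>)
    then show ?thesis by (simp add: \<tau>(2) m_def)
  qed
  \<comment> \<open>The common row sum of the variances; as \<open>c\<close> is constant, the
    diagonal correction becomes the scalar \<open>\<sigma> * m\<close>.\<close>
  define \<sigma> where "\<sigma> = 1 / \<gamma>\<^sup>2 * (\<Sum>d=1..D. p d * (1 - p d) * (real (M d) - 1))"
  have s_row: "(\<Sum>l<N. s k l) = \<sigma>" if k: "k < N" for k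
  proof -
    have "(\<Sum>l<N. s k l) = 1 / \<gamma>\<^sup>2 * (\<Sum>l<N. \<Sum>d=1..D. p d * (1 - p d) * link_entry (\<lambda>e. e = d) k l)"
      using k by (simp add: s sum_distrib_left)
    also have "(\<Sum>l<N. \<Sum>d=1..D. p d * (1 - p d) * link_entry (\<lambda>e. e = d) k l) =
        (\<Sum>d=1..D. p d * (1 - p d) * (\<Sum>l<N. link_entry (\<lambda>e. e = d) k l))"
      by (subst sum.swap) (simp add: sum_distrib_left)
    finally show ?thesis using k by (simp add: row_sum_link_entry \<sigma>_def)
  qed
  have \<sigma>: "0 \<le> \<sigma>" using s_row[OF N] s_nonneg sum_nonneg[of ?I "s 0"] by simp
  \<comment> \<open>The eigenvalue of the inverted matrix on the projection with index
    \<open>j\<close>, and the term inverted on the right of the rational equations.\<close>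
  define g where "g = (\<lambda>j. complex_of_real (1 / \<gamma>) *
      (\<Sum>d=1..D. complex_of_real (p d) * lattice_eigenvalue (M d) 0 (j d)) - z - complex_of_real \<sigma> * m)"
  \<comment> \<open>The eigenvalues of the mean are real, and \<open>Im z\<close> and
    \<open>\<sigma> * Im m\<close> do not have opposite signs, so nothing cancels
    \<open>Im z\<close>.\<close>
  have g_nz: "g j \<noteq> 0" for j
  proof -
    have "lattice_eigenvalue (M d) 0 (j d) = complex_of_real (if j d = 0 then real (M d) - 1 else - 1)" for d
      by (simp add: lattice_eigenvalue_def)
    then have "Im (g j) = - (Im z + \<sigma> * Im m)"
      by (simp add: g_def Im_sum Re_sum)
    moreover have "Im z * (Im z + \<sigma> * Im m) > 0"
    proof -
      have "0 < Im z * Im m" using c_pos[OF N] by (simp add: m_def)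
      then have "0 \<le> \<sigma> * (Im z * Im m)" using \<sigma> by simp
      moreover have "0 < Im z * Im z" using z not_real_square_gt_zero by blast
      moreover have "Im z * (Im z + \<sigma> * Im m) = Im z * Im z + \<sigma> * (Im z * Im m)"
        by (simp add: algebra_simps)
      ultimately show ?thesis by linarith
    qed
    ultimately have "Im (g j) \<noteq> 0" by (metis less_irrefl mult_zero_right neg_equal_0_iff_equal)
    then show ?thesis by auto
  qed

  \<comment> \<open>Diagonalization and inversion\<close>
  have op: "K1_operator ?I ?b s z (\<lambda>k. c k z) k l = (\<Sum>j\<in>J. g j * spectral_entry j k l)"
    if kl: "k < N" "l < N" for k l
  proof -
    have "?b k l = complex_of_real (1 / \<gamma>) *
        (\<Sum>d=1..D. complex_of_real (p d) * (\<Sum>j\<in>J. lattice_eigenvalue (M d) 0 (j d) * spectral_entry j k l))"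
    proof -
      have "complex_of_real (link_entry (\<lambda>e. e = d) k l) =
          (\<Sum>j\<in>J. lattice_eigenvalue (M d) 0 (j d) * spectral_entry j k l)" if "d \<in> {1..D}" for d
        unfolding link_entry_along_spectral[OF that, symmetric] by (rule of_real_link_entry)
      then show ?thesis using kl by (simp add: B)
    qed
    also have "\<dots> = (\<Sum>j\<in>J. (complex_of_real (1 / \<gamma>) *
        (\<Sum>d=1..D. complex_of_real (p d) * lattice_eigenvalue (M d) 0 (j d))) * spectral_entry j k l)"
      by (simp only: sum_distrib_left sum_distrib_right mult.assoc, rule sum.swap)
    finally have b: "?b k l = \<dots>" .
    have "(\<Sum>t<N. complex_of_real (s k t) * c t z) = complex_of_real \<sigma> * m"
      using s_row[OF kl(1)] by (simp add: c_const flip: sum_distrib_right of_real_sum)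
    then have "K1_operator ?I ?b s z (\<lambda>k. c k z) k l =
        ?b k l - (z + complex_of_real \<sigma> * m) * of_bool (k = l)"
      by (cases "k = l") (simp_all add: K1_operator_def)
    then show ?thesis
      unfolding b spectral_function_const[OF kl, symmetric]
      by (simp only: g_def sum_subtractf[symmetric] left_diff_distrib[symmetric] diff_diff_eq)
  qed
  have prod: "(\<Sum>l<N. (\<Sum>j\<in>J. f j * spectral_entry j k l) * (\<Sum>j\<in>J. h j * spectral_entry j l n)) =
      of_bool (k = n)" if "\<And>j. f j * h j = 1" "k < N" "n < N" for f h k n
    using spectral_function_const[OF that(2,3), of 1]
    by (simp only: spectral_function_mult[OF that(2,3)] that(1) mult_1)
  have "inverse_on ?I (\<lambda>k l. \<Sum>j\<in>J. g j * spectral_entry j k l)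
      (\<lambda>k l. \<Sum>j\<in>J. inverse (g j) * spectral_entry j k l)"
    unfolding inverse_on_def using g_nz by (intro conjI ballI prod) auto
  then have "inverse_on ?I (K1_operator ?I ?b s z (\<lambda>k. c k z))
      (\<lambda>k l. \<Sum>j\<in>J. inverse (g j) * spectral_entry j k l)"
    by (rule inverse_on_cong) (simp only: op lessThan_iff)
  \<comment> \<open>Both are inverses of the same matrix; difference zero in the resolvent identity
    makes them equal.\<close>
  from resolvent_identity[OF _ _ _ C this, where \<delta> = "\<lambda>_. 0"]
  have C_eq: "C k l = (\<Sum>j\<in>J. inverse (g j) * spectral_entry j k l)" if "k < N" "l < N" for k l
    using that by simp

  \<comment> \<open>Coefficients with respect to \<open>K\<close> and \<open>I\<close>\<close>
  define \<alpha> where "\<alpha> = (\<lambda>i. \<Sum>j\<in>J. inverse (g j) * (\<Prod>d=1..D. proj_coeff (M d) (j d) (i d)))"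
  have C_\<alpha>: "C k l = (\<Sum>i\<in>J. \<alpha> i * link_entry (\<lambda>d. i d = 0) k l)" if "k < N" "l < N" for k l
  proof -
    have "C k l = (\<Sum>j\<in>J. inverse (g j) *
        (\<Sum>i\<in>J. (\<Prod>d=1..D. proj_coeff (M d) (j d) (i d)) * link_entry (\<lambda>d. i d = 0) k l))"
      using that by (simp add: C_eq spectral_entry_link)
    also have "\<dots> = (\<Sum>i\<in>J. \<alpha> i * link_entry (\<lambda>d. i d = 0) k l)"
      by (simp only: \<alpha>_def sum_distrib_left sum_distrib_right mult.assoc, rule sum.swap)
    finally show ?thesis .
  qed
  let ?one = "\<lambda>d\<in>{1..D}. 1 :: nat"
  have fin: "finite J" by (intro finite_PiE) auto
  have \<alpha>_one: "\<alpha> ?one = m"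
  proof -
    have "m = C 0 0" using C_diag[OF N] by (simp add: m_def)
    \<comment> \<open>A product with some factor \<open>K\<close> has zero diagonal, so entry
      \<open>(0, 0)\<close> isolates the coefficient of the product of identities.\<close>
    also have "\<dots> = (\<Sum>i\<in>J. if i = ?one then \<alpha> i else 0)"
    proof (subst C_\<alpha>[OF N N], rule sum.cong[OF refl])
      fix i assume i: "i \<in> J"
      have "(\<forall>d\<in>{1..D}. i d \<noteq> 0) \<longleftrightarrow> i = ?one"
      proof
        assume nz: "\<forall>d\<in>{1..D}. i d \<noteq> 0"
        have "?one \<in> J" by auto
        with i show "i = ?one"
        proof (rule PiE_ext)
          fix d assume d: "d \<in> {1..D}"
          show "i d = ?one d" using bspec[OF nz d] PiE_mem[OF i d] d by auto
        qed
      qed auto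
      then show "\<alpha> i * link_entry (\<lambda>d. i d = 0) 0 0 = (if i = ?one then \<alpha> i else 0)"
        by (simp add: link_entry_refl)
    qed
    also have "\<dots> = \<alpha> ?one" using fin by (subst sum.delta) auto
    finally show ?thesis by simp
  qed
  have kron: "\<alpha> i \<cdot>\<^sub>m kronecker_prod (\<lambda>d. if i d = 0 then complete_mat (M d) else 1\<^sub>m (M d)) D
      \<in> carrier_mat N N" for i
    unfolding assms(3) by (intro smult_carrier_mat dim_kronecker_prod) (simp add: complete_mat_def)
  have "girko_mat P N W c z = finsum (module_mat TYPE(complex) N N)
      (\<lambda>i. \<alpha> i \<cdot>\<^sub>m kronecker_prod (\<lambda>d. if i d = 0 then complete_mat (M d) else 1\<^sub>m (M d)) D) J"
    (is "_ = ?T")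
  proof (rule eq_matI)
    have T: "?T \<in> carrier_mat N N" by (rule finsum_mat_closed[OF fin kron])
    show "dim_row (girko_mat P N W c z) = dim_row ?T" "dim_col (girko_mat P N W c z) = dim_col ?T"
      using T C_carrier by auto
    fix k l assume "k < dim_row ?T" "l < dim_col ?T"
    then have kl: "k < N" "l < N" using T by auto
    have "?T $$ (k, l) = (\<Sum>i\<in>J. \<alpha> i * link_entry (\<lambda>d. i d = 0) k l)"
      using kl carrier_matD[OF kron]
      by (subst index_finsum_mat[OF fin kron]) (auto simp: complex_entry intro!: sum.cong)
    then show "girko_mat P N W c z $$ (k, l) = ?T $$ (k, l)"
      using C_\<alpha>[OF kl] by (simp add: C_def)
  qed
  moreover have "stieltjes_transform F z = \<alpha> ?one"
    unfolding \<alpha>_one using N by (simp add: S c_const)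
  \<comment> \<open>Inserting \<open>\<alpha>\<close> and exchanging the sums leaves, by duality,
    only the reciprocal eigenvalue with index \<open>j\<close>.\<close>
  moreover have "(\<Sum>i\<in>J. \<alpha> i * (\<Prod>d=1..D. lattice_eigenvalue (M d) (i d) (j d))) = inverse (g j)"
    if j: "j \<in> J" for j
  proof -
    have "(\<Sum>i\<in>J. \<alpha> i * (\<Prod>d=1..D. lattice_eigenvalue (M d) (i d) (j d))) =
        (\<Sum>j'\<in>J. inverse (g j') * (\<Sum>i\<in>J. (\<Prod>d=1..D. proj_coeff (M d) (j' d) (i d)) *
          (\<Prod>d=1..D. lattice_eigenvalue (M d) (i d) (j d))))"
      by (simp only: \<alpha>_def sum_distrib_left sum_distrib_right mult.assoc, rule sum.swap)
    also have "\<dots> = (\<Sum>j'\<in>J. if j' = j then inverse (g j) else 0)"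
    proof (rule sum.cong[OF refl])
      fix j' assume "j' \<in> J"
      from sum_proj_coeff_eigenvalue[OF this j]
      show "inverse (g j') * (\<Sum>i\<in>J. (\<Prod>d=1..D. proj_coeff (M d) (j' d) (i d)) *
          (\<Prod>d=1..D. lattice_eigenvalue (M d) (i d) (j d))) = (if j' = j then inverse (g j) else 0)"
        by (simp only:) simp
    qed
    finally show ?thesis using fin j by simp
  qed
  ultimately show "\<exists>\<alpha> :: (nat \<Rightarrow> nat) \<Rightarrow> complex.
      girko_mat P N W c z =
        finsum (module_mat TYPE(complex) N N)
          (\<lambda>i. \<alpha> i \<cdot>\<^sub>m kronecker_prod
                 (\<lambda>d. if i d = 0 then complete_mat (M d) else 1\<^sub>m (M d)) D)
          ({1..D} \<rightarrow>\<^sub>E {0, 1}) \<and>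
      stieltjes_transform F z = \<alpha> (\<lambda>d\<in>{1..D}. 1) \<and>
      (\<forall>j \<in> {1..D} \<rightarrow>\<^sub>E {0, 1}.
        (\<Sum>i \<in> {1..D} \<rightarrow>\<^sub>E {0, 1}. \<alpha> i * (\<Prod>d=1..D. lattice_eigenvalue (M d) (i d) (j d))) =
        inverse
          (complex_of_real (1 / \<gamma>) *
             (\<Sum>d=1..D. complex_of_real (p d) * lattice_eigenvalue (M d) 0 (j d))
           - z
           - complex_of_real (1 / \<gamma>\<^sup>2 * (\<Sum>d=1..D. p d * (1 - p d) * (real (M d) - 1))) *
             \<alpha> (\<lambda>d\<in>{1..D}. 1)))"
    by (intro exI[of _ \<alpha>] conjI ballI) (simp_all only: \<alpha>_one g_def \<sigma>_def)
qed

end
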